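(* Let $\{x^n\}_{n\ge 0}$ be a sequence generated by the CCD algorithm with stepsize $\mu$ for the $l_q$ regularization problem with data $(A,y,\lambda,q)$. Assume that $0<\mu<L_{\max}^{-1}$ and $T_\lambda(x^0)<+\infty$. Then $\{x^n\}$ converges to a stationary point.
   Context: Let $m,N$ be positive integers, $A\in\mathbb{R}^{m\times N}$ with columns $A_1,\dots,A_N$, $y\in\mathbb{R}^m$, $\lambda>0$, $0<q<1$. The $l_q$ regularization problem is to minimize over $x\in\mathbb{R}^N$ $$T_\lambda(x)=\tfrac12\|Ax-y\|_2^2+\lambda\|x\|_q^q,\qquad \|x\|_q^q=\sum_{i=1}^N|x_i|^q.$$ Set $L_{\max}=\max_i\|A_i\|_2^2$. For $\mu>0$ let $$\eta_{\mu,q}=(2\lambda\mu(1-q))^{\frac1{2-q}},\qquad \tau_{\mu,q}=\frac{2-q}{2-2q}(2\lambda\mu(1-q))^{\frac1{2-q}},$$ and for $z\in\mathbb{R}$ let $prox_{\lambda\mu,q}(z)=\arg\min_{v\in\mathbb{R}}\{\frac{|z-v|^2}{2}+\lambda\mu|v|^q\}$; the minimizer is unique unless $|z|=\tau_{\mu,q}$, in which case the minimizers are $0$ and $\mathrm{sgn}(z)\eta_{\mu,q}$. CCD algorithm with stepsize $\mu>0$: start from an arbitrary $x^0\in\mathbb{R}^N$. Given $x^n$ ($n=0,1,2,\dots$), let $i\in\{1,\dots,N\}$ be the index with $i\equiv n+1 \pmod N$, put $z_i^n=x_i^n-\mu A_i^T(Ax^n-y)$, and set $x_i^{n+1}=\mathcal{T}(z_i^n,x_i^n)$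 and $x_j^{n+1}=x_j^n$ for $j\ne i$, where $\mathcal{T}(z,t)=prox_{\lambda\mu,q}(z)$ if $|z|\neq\tau_{\mu,q}$, and, if $|z|=\tau_{\mu,q}$, $\mathcal{T}(z,t)=\mathrm{sgn}(z)\eta_{\mu,q}$ when $t\ne0$ and $\mathcal{T}(z,t)=0$ when $t=0$. The sequence is the infinite one obtained without a stopping rule. A point $x^*\in\mathbb{R}^N$ with support $Supp(x^* )=\{i:x_i^*\neq0\}$ is called a stationary point (of the $l_q$ regularization problem, for the given $\mu$) if: (a) $|x_i^*|\ge\eta_{\mu,q}$ for $i\in Supp(x^* )$; (b) $A_i^T(Ax^*-y)+\lambda q\,\mathrm{sgn}(x_i^* )|x_i^*|^{q-1}=0$ for $i\in Supp(x^* )$; (c) $|A_i^T(Ax^*-y)|\le\tau_{\mu,q}/\mu$ for $i\notin Supp(x^* )$. *)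

theory Defs
  imports "HOL-Analysis.Analysis"
begin

text \<open>
  Vectors of length \<open>N\<close> are elements of \<^typ>\<open>real ^ 'n\<close> with \<open>N = CARD('n)\<close>, and an
  \<open>m \<times> N\<close> matrix is an element of \<^typ>\<open>real ^ 'n ^ 'm\<close>.
\<close>

definition lq_objective ::
    "real ^ 'n ^ 'm \<Rightarrow> real ^ 'm \<Rightarrow> real \<Rightarrow> real \<Rightarrow> real ^ 'n \<Rightarrow> real" where
  "lq_objective A y lam q x =
     (norm (A *v x - y))\<^sup>2 / 2 + lam * (\<Sum>i\<in>UNIV. \<bar>x $ i\<bar> powr q)"

text \<open>
  For \<open>A = 0\<close> this is \<open>0\<close>. Its reciprocal should then be read in \<^typ>\<open>ereal\<close>, where it is
  \<open>\<infinity>\<close>, and not in \<^typ>\<open>real\<close>, where it is \<open>0\<close>.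
\<close>

definition Lmax :: "real ^ 'n ^ 'm \<Rightarrow> real" where
  "Lmax A = (MAX i\<in>UNIV. (norm (column i A))\<^sup>2)"

definition lq_eta :: "real \<Rightarrow> real \<Rightarrow> real \<Rightarrow> real" where
  "lq_eta lam mu q = (2 * lam * mu * (1 - q)) powr (1 / (2 - q))"

definition lq_tau :: "real \<Rightarrow> real \<Rightarrow> real \<Rightarrow> real" where
  "lq_tau lam mu q = (2 - q) / (2 - 2 * q) * (2 * lam * mu * (1 - q)) powr (1 / (2 - q))"

text \<open>
  The minimizer is unique when \<open>\<bar>z\<bar> \<noteq> \<tau>\<close>. When \<open>\<bar>z\<bar> = \<tau>\<close> there are two minimizers and
  the constant below denotes an unspecified one of them; it is never used in that case.
\<close>

definition lq_prox :: "real \<Rightarrow> real \<Rightarrow> real \<Rightarrow> real \<Rightarrow> real" where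
  "lq_prox lam mu q z = (ARG_MIN (\<lambda>v. \<bar>z - v\<bar>\<^sup>2 / 2 + lam * mu * \<bar>v\<bar> powr q) v. True)"

definition lq_threshold :: "real \<Rightarrow> real \<Rightarrow> real \<Rightarrow> real \<Rightarrow> real \<Rightarrow> real" where
  "lq_threshold lam mu q z t =
     (if \<bar>z\<bar> \<noteq> lq_tau lam mu q then lq_prox lam mu q z
      else if t \<noteq> 0 then sgn z * lq_eta lam mu q
      else 0)"

text \<open>
  The index type \<^typ>\<open>'n\<close> carries no order, so the numbering \<open>1, \<dots>, N\<close> of the coordinates that
  determines the cyclic update order is given by a map \<open>e\<close>, meant to be a bijection from
  \<open>{1..N}\<close> onto the index type: the \<open>k\<close>-th coordinate is \<open>x $ e k\<close>.
\<close>

definition CCD_sequence ::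
    "(nat \<Rightarrow> 'n) \<Rightarrow> real ^ 'n ^ 'm \<Rightarrow> real ^ 'm \<Rightarrow> real \<Rightarrow> real \<Rightarrow> real \<Rightarrow> (nat \<Rightarrow> real ^ 'n) \<Rightarrow> bool" where
  "CCD_sequence e A y lam q mu x \<longleftrightarrow>
     (\<forall>n. \<exists>k\<in>{1..CARD('n)}. k mod CARD('n) = (n + 1) mod CARD('n) \<and>
        (let i = e k;
             z = x n $ i - mu * (column i A \<bullet> (A *v x n - y))
         in x (n + 1) $ i = lq_threshold lam mu q z (x n $ i) \<and>
            (\<forall>j. j \<noteq> i \<longrightarrow> x (n + 1) $ j = x n $ j)))"

definition Supp :: "real ^ 'n \<Rightarrow> 'n set" where
  "Supp x = {i. x $ i \<noteq> 0}"

definition lq_stationary_point ::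
    "real ^ 'n ^ 'm \<Rightarrow> real ^ 'm \<Rightarrow> real \<Rightarrow> real \<Rightarrow> real \<Rightarrow> real ^ 'n \<Rightarrow> bool" where
  "lq_stationary_point A y lam q mu x \<longleftrightarrow>
     (\<forall>i\<in>Supp x. \<bar>x $ i\<bar> \<ge> lq_eta lam mu q) \<and>
     (\<forall>i\<in>Supp x.
        column i A \<bullet> (A *v x - y) + lam * q * sgn (x $ i) * \<bar>x $ i\<bar> powr (q - 1) = 0) \<and>
     (\<forall>i. i \<notin> Supp x \<longrightarrow> \<bar>column i A \<bullet> (A *v x - y)\<bar> \<le> lq_tau lam mu q / mu)"

end

theory Submission
  imports Defs "HOL-Complex_Analysis.Conformal_Mappings"
begin

text \<open>
  Each update decreases the objective by a multiple of the squared step, so the sequence is bounded,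
  its steps tend to \<open>0\<close>, and the local optimality conditions of the threshold operator pass to the
  limit: every cluster point is stationary. The cluster points form a connected set, so it remains to
  see that no connected set of stationary points has more than one element. This takes the place
  of the Kurdyka-Lojasiewicz inequality.

  On such a set the support and the signs are constant, and after removing them the points are
  positive solutions of \<open>C x + s u = b\<close> with \<open>C\<close> a Gram matrix and \<open>u = x powr (q - 1)\<close>. Regard \<open>x\<close>
  and \<open>u\<close> as independent complex coordinates and let \<open>I\<close> be the ideal of polynomials vanishing on the
  connected set. Since that set has no isolated points, Gaussian elimination yields a polynomial vector
  field \<open>X\<close>, not identically zero, that is tangent to the foliation \<open>u = const * x powr (q - 1)\<close> and maps
  \<open>I\<close> into \<open>I\<close>; its holomorphic flow therefore stays in the zero set of \<open>I\<close>. Because \<open>C\<close> is positive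
  semidefinite, \<open>u\<close> is bounded on the part \<open>W\<close> of this zero set where \<open>\<bar>u\<bar> = \<bar>x\<bar> powr (q - 1)\<close>. Hence, for a
  component \<open>h\<close> of \<open>X\<close> and large \<open>k\<close>, the function
  \<open>\<bar>h\<bar> * (\<Prod>j. \<bar>x j\<bar> powr (- k)) * exp (\<Sum>j. \<bar>u j\<bar>\<^sup>2)\<close> tends to \<open>0\<close> at infinity on \<open>W\<close> and attains a positive
  maximum. Along the flow its logarithm is subharmonic, and constant only if \<open>u\<close> is, so the maximum
  principle forces \<open>X\<close> to vanish at the maximum, where \<open>h\<close> does not.
\<close>

section \<open>Polynomial functions on complex vectors\<close>

text \<open>Polynomials are encoded as functions generated by the ring operations, so that rule
  induction proves their properties and they can be evaluated directly along curves.\<close>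

inductive_set polyfun :: "(complex ^ 'v \<Rightarrow> complex) set" where
  const: "(\<lambda>_. c) \<in> polyfun"
| coord: "(\<lambda>z. z $ v) \<in> polyfun"
| add: "f \<in> polyfun \<Longrightarrow> g \<in> polyfun \<Longrightarrow> (\<lambda>z. f z + g z) \<in> polyfun"
| mult: "f \<in> polyfun \<Longrightarrow> g \<in> polyfun \<Longrightarrow> (\<lambda>z. f z * g z) \<in> polyfun"

lemma polyfun_sum:
  assumes "\<And>i. i \<in> S \<Longrightarrow> f i \<in> polyfun"
  shows "(\<lambda>z. \<Sum>i\<in>S. f i z) \<in> polyfun"
  using assms by (induction S rule: infinite_finite_induct) (auto intro: polyfun.intros)

definition partial_deriv :: "'v \<Rightarrow> (complex ^ 'v \<Rightarrow> complex) \<Rightarrow> complex ^ 'v \<Rightarrow> complex" where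
  "partial_deriv v f z = frechet_derivative f (at z) (axis v 1)"

text \<open>The induction carries unnamed polynomial coefficients; uniqueness of the derivative
  identifies them with \<open>partial_deriv\<close> afterwards. As \<open>has_derivative\<close> is
  a real notion, complex linearity is recorded in the form of the map.\<close>

lemma polyfun_derivative_ex:
  assumes "f \<in> polyfun"
  shows "\<exists>g. (\<forall>v. g v \<in> polyfun) \<and>
    (\<forall>z. (f has_derivative (\<lambda>d. \<Sum>v\<in>UNIV. g v z * d $ v)) (at z))"
  using assms
proof induction
  case (const c)
  show ?case
    by (rule exI[of _ "\<lambda>_ _. 0"]) (auto intro: polyfun.intros)
next
  case (coord w)
  have "(\<Sum>v\<in>UNIV. (if v = w then 1 else 0) * d $ v) = d $ w" for d :: "complex ^ 'a"
    by (simp add: if_distrib [of "\<lambda>c. c * _"] sum.delta cong: if_cong)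
  then show ?case
    by (intro exI[of _ "\<lambda>v _. if v = w then 1 else 0"])
       (auto intro: polyfun.intros bounded_linear_imp_has_derivative bounded_linear_vec_nth)
next
  case (add f g)
  then obtain f' g' where "\<And>v. f' v \<in> polyfun" "\<And>v. g' v \<in> polyfun"
    and "\<And>z. (f has_derivative (\<lambda>d. \<Sum>v\<in>UNIV. f' v z * d $ v)) (at z)"
    and "\<And>z. (g has_derivative (\<lambda>d. \<Sum>v\<in>UNIV. g' v z * d $ v)) (at z)"
    by blast
  then show ?case
    by (intro exI[of _ "\<lambda>v z. f' v z + g' v z"])
       (auto intro!: polyfun.intros has_derivative_eq_rhs [OF has_derivative_add]
          simp: algebra_simps sum.distrib)
next
  case (mult f g)
  then obtain f' g' where "\<And>v. f' v \<in> polyfun" "\<And>v. g' v \<in> polyfun"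
    and "\<And>z. (f has_derivative (\<lambda>d. \<Sum>v\<in>UNIV. f' v z * d $ v)) (at z)"
    and "\<And>z. (g has_derivative (\<lambda>d. \<Sum>v\<in>UNIV. g' v z * d $ v)) (at z)"
    by blast
  with mult show ?case
    by (intro exI[of _ "\<lambda>v z. f z * g' v z + f' v z * g z"])
       (auto intro!: polyfun.intros has_derivative_eq_rhs [OF has_derivative_mult]
          simp: algebra_simps sum.distrib sum_distrib_left)
qed

lemma
  assumes "f \<in> polyfun"
  shows polyfun_partial_deriv: "partial_deriv v f \<in> polyfun"
    and polyfun_has_derivative:
      "(f has_derivative (\<lambda>d. \<Sum>v\<in>UNIV. partial_deriv v f z * d $ v)) (at z)"
proof -
  obtain g where g: "\<And>v. g v \<in> polyfun"
    "\<And>z. (f has_derivative (\<lambda>d. \<Sum>v\<in>UNIV. g v z * d $ v)) (at z)"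
    using polyfun_derivative_ex[OF assms] by blast
  have eq: "partial_deriv v f = g v" for v
  proof
    fix z
    have "partial_deriv v f z = (\<Sum>w\<in>UNIV. g w z * axis v 1 $ w)"
      unfolding partial_deriv_def using frechet_derivative_at[OF g(2)] by metis
    also have "\<dots> = g v z"
      by (simp add: axis_def if_distrib [of "\<lambda>c. _ * c"] sum.delta cong: if_cong)
    finally show "partial_deriv v f z = g v z" .
  qed
  show "partial_deriv v f \<in> polyfun"
    "(f has_derivative (\<lambda>d. \<Sum>v\<in>UNIV. partial_deriv v f z * d $ v)) (at z)"
    using g by (simp_all add: eq)
qed

lemma polyfun_continuous_on: "f \<in> polyfun \<Longrightarrow> continuous_on S f"
  by (meson polyfun_has_derivative has_derivative_continuous continuous_at_imp_continuous_on)

text \<open>The derivative of \<open>f\<close> is complex linear by its form, so the real chain rule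
  along a complex differentiable curve already yields a complex derivative.\<close>

lemma polyfun_along_curve:
  fixes \<gamma> :: "complex \<Rightarrow> complex ^ 'v"
  assumes "f \<in> polyfun"
    and "\<And>v. ((\<lambda>t. \<gamma> t $ v) has_field_derivative \<gamma>' v) (at t)"
  shows "((\<lambda>t. f (\<gamma> t)) has_field_derivative (\<Sum>v\<in>UNIV. partial_deriv v f (\<gamma> t) * \<gamma>' v)) (at t)"
proof -
  have "(\<gamma> has_derivative (\<lambda>h. \<chi> v. \<gamma>' v * h)) (at t)"
  proof (subst has_derivative_componentwise_within, intro ballI)
    fix i :: "complex ^ 'v" assume "i \<in> Basis"
    then obtain v b where "i = axis v b"
      by (auto simp: Basis_vec_def)
    moreover have "((\<lambda>t. \<gamma> t $ v \<bullet> b) has_derivative (\<lambda>h. (\<gamma>' v * h) \<bullet> b)) (at t)"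
      using assms(2)[of v] by (intro has_derivative_inner_left) (simp add: has_field_derivative_def)
    ultimately show "((\<lambda>t. \<gamma> t \<bullet> i) has_derivative (\<lambda>h. (\<chi> v. \<gamma>' v * h) \<bullet> i)) (at t)"
      by (simp add: inner_axis)
  qed
  from diff_chain_at[OF this polyfun_has_derivative[OF assms(1)]] show ?thesis
    by (simp add: has_field_derivative_def o_def)
      (erule has_derivative_eq_rhs, simp add: fun_eq_iff sum_distrib_right mult.assoc)
qed

lemma polyfun_growth:
  assumes "f \<in> polyfun"
  obtains C d where "C \<ge> 0" "\<And>z. norm (f z) \<le> C * (1 + norm z) ^ d"
proof -
  have "\<exists>C d. C \<ge> 0 \<and> (\<forall>z. norm (f z) \<le> C * (1 + norm z) ^ d)"
    using assms
  proof induction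
    case (const c)
    show ?case by (rule exI[of _ "norm c"], rule exI[of _ 0]) simp
  next
    case (coord v)
    have "norm (z $ v) \<le> 1 + norm z" for z :: "complex ^ 'a"
      using Finite_Cartesian_Product.norm_nth_le[of z v] by linarith
    then show ?case by (intro exI[of _ 1]) auto
  next
    case (add f g)
    then obtain C d C' d' where C: "C \<ge> 0" "C' \<ge> 0"
      and b: "\<And>z. norm (f z) \<le> C * (1 + norm z) ^ d" "\<And>z. norm (g z) \<le> C' * (1 + norm z) ^ d'"
      by blast
    have "norm (f z + g z) \<le> (C + C') * (1 + norm z) ^ (d + d')" for z
    proof -
      have "C * (1 + norm z) ^ d \<le> C * (1 + norm z) ^ (d + d')"
        "C' * (1 + norm z) ^ d' \<le> C' * (1 + norm z) ^ (d + d')"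
        using C by (auto intro!: mult_left_mono power_increasing)
      then show ?thesis
        using b[of z] norm_triangle_ineq[of "f z" "g z"] by (simp add: algebra_simps)
    qed
    with C show ?case by (intro exI[of _ "C + C'"] exI[of _ "d + d'"]) auto
  next
    case (mult f g)
    then obtain C d C' d' where C: "C \<ge> 0" "C' \<ge> 0"
      and b: "\<And>z. norm (f z) \<le> C * (1 + norm z) ^ d" "\<And>z. norm (g z) \<le> C' * (1 + norm z) ^ d'"
      by blast
    have "norm (f z * g z) \<le> (C * C') * (1 + norm z) ^ (d + d')" for z
    proof -
      have "norm (f z) * norm (g z) \<le> (C * (1 + norm z) ^ d) * (C' * (1 + norm z) ^ d')"
        using b[of z] C by (intro mult_mono) auto
      then show ?thesis by (simp add: norm_mult power_add algebra_simps)
    qed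
    with C show ?case by (intro exI[of _ "C * C'"] exI[of _ "d + d'"]) auto
  qed
  then show ?thesis using that by blast
qed

text \<open>Radius and distance are measured coordinate by coordinate, as in the Picard iteration.
  One constant serves as Lipschitz constant and as bound, because the product case of the induction
  needs both for its factors.\<close>

lemma polyfun_lipschitz_sup:
  fixes f :: "complex ^ 'v \<Rightarrow> complex"
  assumes "f \<in> polyfun"
  obtains L where "L \<ge> 0"
    "\<And>z z' c. (\<And>v. norm (z $ v) \<le> R) \<Longrightarrow> (\<And>v. norm (z' $ v) \<le> R) \<Longrightarrow>
       (\<And>v. norm (z $ v - z' $ v) \<le> c) \<Longrightarrow> norm (f z - f z') \<le> L * c"
    "\<And>z. (\<And>v. norm (z $ v) \<le> R) \<Longrightarrow> norm (f z) \<le> L"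
proof -
  define B where "B z \<longleftrightarrow> (\<forall>v. norm (z $ v) \<le> R)" for z :: "complex ^ 'v"
  define N where "N c z z' \<longleftrightarrow> (\<forall>v. norm (z $ v - z' $ v) \<le> c)" for c and z z' :: "complex ^ 'v"
  have N0: "c \<ge> 0" if "N c z z'" for c z z'
    using that order_trans[OF norm_ge_zero, of "z $ undefined - z' $ undefined" c] by (simp add: N_def)
  define P where "P L f \<longleftrightarrow>
      (\<forall>z z' c. B z \<longrightarrow> B z' \<longrightarrow> N c z z' \<longrightarrow> norm (f z - f z') \<le> L * c) \<and>
      (\<forall>z. B z \<longrightarrow> norm (f z) \<le> L)" for L and f :: "complex ^ 'v \<Rightarrow> complex"
  have PI: "P L f" if "\<And>z z' c. B z \<Longrightarrow> B z' \<Longrightarrow> N c z z' \<Longrightarrow> norm (f z - f z') \<le> L * c"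
    "\<And>z. B z \<Longrightarrow> norm (f z) \<le> L" for L f
    using that by (simp add: P_def)
  have PD: "norm (f z - f z') \<le> L * c" if "P L f" "B z" "B z'" "N c z z'" for L f z z' c
    using that by (simp add: P_def)
  have PB: "norm (f z) \<le> L" if "P L f" "B z" for L f z
    using that by (simp add: P_def)
  have "\<exists>L\<ge>0. P L f"
    using assms
  proof induction
    case (const k)
    show ?case
    proof (intro exI[of _ "norm k"] conjI PI)
      fix z z' :: "complex ^ 'v" and c assume "N c z z'"
      from N0[OF this] show "norm (k - k) \<le> norm k * c" by simp
    qed simp_all
  next
    case (coord v)
    show ?case
    \<comment> \<open>1 is the Lipschitz constant of a coordinate and \<open>R\<close> bounds it;
      the maximum stays nonnegative even if \<open>R < 0\<close>.\<close>
    proof (intro exI[of _ "max 1 R"] conjI PI)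
      fix z z' :: "complex ^ 'v" and c assume c: "N c z z'"
      have "c \<le> max 1 R * c" using mult_right_mono[of 1 "max 1 R" c] N0[OF c] by simp
      moreover have "norm (z $ v - z' $ v) \<le> c" using c by (simp add: N_def)
      ultimately show "norm (z $ v - z' $ v) \<le> max 1 R * c" by linarith
    qed (simp_all add: le_max_iff_disj B_def)
  next
    case (add f g)
    then obtain L L' where L: "L \<ge> 0" "L' \<ge> 0" and f: "P L f" and g: "P L' g"
      by blast
    show ?case
    proof (intro exI[of _ "L + L'"] conjI PI)
      fix z z' c assume "B z" "B z'" "N c z z'"
      then show "norm (f z + g z - (f z' + g z')) \<le> (L + L') * c"
        using norm_triangle_ineq[of "f z - f z'" "g z - g z'"] PD[OF f, of z z' c] PD[OF g, of z z' c]
        by (simp add: algebra_simps)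
    next
      fix z assume "B z"
      then show "norm (f z + g z) \<le> L + L'"
        using norm_triangle_ineq[of "f z" "g z"] PB[OF f, of z] PB[OF g, of z] by linarith
    qed (use L in auto)
  next
    case (mult f g)
    then obtain L L' where L: "L \<ge> 0" "L' \<ge> 0" and f: "P L f" and g: "P L' g"
      by blast
    show ?case
    proof (intro exI[of _ "2 * L * L'"] conjI PI)
      fix z z' c assume a: "B z" "B z'" "N c z z'"
      have "f z * g z - f z' * g z' = f z * (g z - g z') + (f z - f z') * g z'"
        by (simp add: algebra_simps)
      also have "norm \<dots> \<le> norm (f z) * norm (g z - g z') + norm (f z - f z') * norm (g z')"
        by (metis norm_mult norm_triangle_ineq)
      also have "\<dots> \<le> L * (L' * c) + (L * c) * L'"
        using PD[OF f a] PD[OF g a] PB[OF f a(1)] PB[OF g a(2)] L N0[OF a(3)]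
        by (intro add_mono mult_mono) auto
      finally show "norm (f z * g z - f z' * g z') \<le> 2 * L * L' * c"
        by (simp add: algebra_simps)
    next
      fix z assume "B z"
      then have "norm (f z) * norm (g z) \<le> L * L'"
        using L PB[OF f, of z] PB[OF g, of z] by (intro mult_mono) auto
      moreover have "0 \<le> L * L'" using L by simp
      ultimately show "norm (f z * g z) \<le> 2 * L * L'"
        by (simp add: norm_mult)
    qed (use L in auto)
  qed
  then obtain L where L: "L \<ge> 0" "P L f" by blast
  show ?thesis
  proof (rule that[of L])
    show "norm (f z - f z') \<le> L * c" if "\<And>v. norm (z $ v) \<le> R" "\<And>v. norm (z' $ v) \<le> R"
      "\<And>v. norm (z $ v - z' $ v) \<le> c" for z z' c
      using PD[OF L(2)] that by (simp add: B_def N_def)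
    show "norm (f z) \<le> L" if "\<And>v. norm (z $ v) \<le> R" for z
      using PB[OF L(2)] that by (simp add: B_def)
  qed (fact L(1))
qed

section \<open>Holomorphic flows of polynomial vector fields\<close>

theorem polynomial_ode_local_solution:
  fixes F :: "'v::finite \<Rightarrow> complex ^ 'v \<Rightarrow> complex"
  assumes F: "\<And>v. F v \<in> polyfun"
  obtains \<delta> \<gamma> where "\<delta> > 0" "\<gamma> 0 = z0"
    "\<And>t v. t \<in> ball 0 \<delta> \<Longrightarrow> ((\<lambda>t. \<gamma> t $ v) has_field_derivative F v (\<gamma> t)) (at t)"
proof -
  \<comment> \<open>The bounds below hold in a region leaving room 1 around \<open>z0\<close>, while
    each integral over \<open>S\<close> has size at most \<open>M * \<delta> = 1 / 2\<close>, so no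
    iterate leaves the region.\<close>
  define R where "R = 1 + norm z0"
  have "\<exists>L\<ge>0. (\<forall>z z' c. (\<forall>v. norm (z $ v) \<le> R) \<longrightarrow> (\<forall>v. norm (z' $ v) \<le> R) \<longrightarrow>
       (\<forall>v. norm (z $ v - z' $ v) \<le> c) \<longrightarrow> norm (F v z - F v z') \<le> L * c) \<and>
       (\<forall>z. (\<forall>v. norm (z $ v) \<le> R) \<longrightarrow> norm (F v z) \<le> L)" for v
    by (rule polyfun_lipschitz_sup[OF F[of v], of R]) blast
  then obtain L where L: "\<And>v. L v \<ge> 0"
    and lip: "\<And>v z z' c. (\<And>v. norm (z $ v) \<le> R) \<Longrightarrow> (\<And>v. norm (z' $ v) \<le> R) \<Longrightarrow>
       (\<And>v. norm (z $ v - z' $ v) \<le> c) \<Longrightarrow> norm (F v z - F v z') \<le> L v * c"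
    and bnd: "\<And>v z. (\<And>v. norm (z $ v) \<le> R) \<Longrightarrow> norm (F v z) \<le> L v"
    by metis
  define M where "M = 1 + (\<Sum>v\<in>UNIV. L v)"
  have LM: "L v \<le> M" for v
    using member_le_sum[of v UNIV L] L by (auto simp: M_def)
  have M: "M \<ge> 1" using L by (simp add: M_def sum_nonneg)
  define \<delta> where "\<delta> = 1 / (2 * M)"
  have \<delta>: "\<delta> > 0" "M * \<delta> = 1 / 2" using M by (auto simp: \<delta>_def)
  define S where "S = ball (0::complex) \<delta>"
  have S: "open S" "convex S" "0 \<in> S" using \<delta> by (auto simp: S_def)
  \<comment> \<open>\<open>prim f\<close> plays the role of the integral of \<open>f\<close> from 0;
    for holomorphic \<open>f\<close> it exists because the disc \<open>S\<close> is convex.\<close>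
  define prim where
    "prim f = (SOME p. p 0 = 0 \<and> (\<forall>t\<in>S. (p has_field_derivative f t) (at t)))"
    for f :: "complex \<Rightarrow> complex"
  have prim_ex: "\<exists>p. p 0 = 0 \<and> (\<forall>t\<in>S. (p has_field_derivative f t) (at t))"
    if f: "f holomorphic_on S" for f
  proof -
    obtain g where g: "\<And>t. t \<in> S \<Longrightarrow> (g has_field_derivative f t) (at t within S)"
      using holomorphic_convex_primitive'[OF S(2,1) f] by blast
    have "((\<lambda>t. g t - g 0) has_field_derivative f t) (at t)" if "t \<in> S" for t
      using g[OF that] at_within_open[OF that S(1)] by (auto intro!: derivative_eq_intros)
    then show ?thesis by (intro exI[of _ "\<lambda>t. g t - g 0"]) auto
  qed
  have prim0: "prim f 0 = 0"
    and prim: "\<And>t. t \<in> S \<Longrightarrow> (prim f has_field_derivative f t) (at t)"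
    if "f holomorphic_on S" for f
    using someI_ex[OF prim_ex[OF that]] by (auto simp: prim_def)
  have bound0: "norm (p t) \<le> B * \<delta>"
    if "\<And>t. t \<in> S \<Longrightarrow> (p has_field_derivative f t) (at t)" "p 0 = 0" "t \<in> S"
      "\<And>s. s \<in> S \<Longrightarrow> norm (f s) \<le> B" for p f t B
  proof -
    have "norm (p t - p 0) \<le> B * norm (t - 0)"
      using that S by (intro field_differentiable_bound[of S _ f]) (auto intro: has_field_derivative_at_within)
    also have "\<dots> \<le> B * \<delta>"
      using that(3) order_trans[OF norm_ge_zero that(4)[OF S(3)]]
      by (intro mult_left_mono) (auto simp: S_def)
    finally show ?thesis by (simp add: that)
  qed
  have prim_bound: "norm (prim f t) \<le> B * \<delta>"
    if "f holomorphic_on S" "t \<in> S" "\<And>s. s \<in> S \<Longrightarrow> norm (f s) \<le> B" for f t B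
    using that bound0[OF prim prim0] by blast
  have prim_diff_bound: "norm (prim f t - prim h t) \<le> B * \<delta>"
    if "f holomorphic_on S" "h holomorphic_on S" "t \<in> S"
      "\<And>s. s \<in> S \<Longrightarrow> norm (f s - h s) \<le> B" for f h t B
    using that prim0
    by (intro bound0[of "\<lambda>t. prim f t - prim h t" "\<lambda>t. f t - h t"])
      (auto intro!: derivative_intros prim)
  \<comment> \<open>Picard iteration; on \<open>S\<close> the integral operator contracts by the factor \<open>M * \<delta> = 1/2\<close>.\<close>
  define G where "G k = ((\<lambda>\<gamma> t. \<chi> v. z0 $ v + prim (\<lambda>s. F v (\<gamma> s)) t) ^^ k) (\<lambda>_. z0)" for k
  have G0: "G 0 t = z0" for t by (simp add: G_def)
  have GS: "G (Suc k) t $ v = z0 $ v + prim (\<lambda>s. F v (G k s)) t" for k t v by (simp add: G_def)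
  have hol_comp: "(\<lambda>s. F v (g s)) holomorphic_on S"
    if "\<And>v. (\<lambda>s. g s $ v) holomorphic_on S" for g v
  proof -
    have d: "((\<lambda>t. g t $ v) has_field_derivative deriv (\<lambda>t. g t $ v) t) (at t)" if "t \<in> S" for t v
      using \<open>\<And>v. (\<lambda>s. g s $ v) holomorphic_on S\<close> that S(1) by (auto intro: holomorphic_derivI)
    show ?thesis
      unfolding holomorphic_on_open[OF S(1)] using polyfun_along_curve[OF F d] by blast
  qed
  have Ghol: "(\<lambda>t. G k t $ v) holomorphic_on S" for k v
  proof (induction k arbitrary: v)
    case (Suc k)
    have "prim (\<lambda>s. F v (G k s)) holomorphic_on S"
      using prim[OF hol_comp[OF Suc]] S(1) by (auto simp: holomorphic_on_open)
    then show ?case by (simp add: GS holomorphic_on_add)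
  qed (simp add: G0)
  note FG = hol_comp[OF Ghol]
  have bndM: "norm (F v z) \<le> M" if "\<And>v. norm (z $ v) \<le> R" for v z
    using bnd[OF that] LM order_trans by blast
  have z0R: "norm (z0 $ v) \<le> R - 1" for v
    using Finite_Cartesian_Product.norm_nth_le[of z0 v] by (simp add: R_def)
  have GR: "norm (G k t $ v) \<le> R" if "t \<in> S" for k t v
    using that
  proof (induction k arbitrary: t v)
    case (Suc k)
    have "norm (prim (\<lambda>s. F v (G k s)) t) \<le> M * \<delta>"
      using Suc by (intro prim_bound FG bndM) auto
    then show ?case
      using \<delta>(2) norm_triangle_ineq[of "z0 $ v" "prim (\<lambda>s. F v (G k s)) t"] z0R[of v] by (simp add: GS)
  next
    case 0 show ?case using z0R[of v] by (simp add: G0)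
  qed
  have step: "norm (G (Suc k) t $ v - G k t $ v) \<le> (1/2) ^ Suc k" if "t \<in> S" for k t v
    using that
  proof (induction k arbitrary: t v)
    case 0
    have "norm (prim (\<lambda>s. F v (G 0 s)) t) \<le> M * \<delta>"
      using 0 GR by (intro prim_bound FG bndM) auto
    then show ?case using \<delta>(2) by (simp add: GS G0)
  next
    case (Suc k)
    have "norm (prim (\<lambda>s. F v (G (Suc k) s)) t - prim (\<lambda>s. F v (G k s)) t) \<le> (M * (1/2) ^ Suc k) * \<delta>"
    proof (intro prim_diff_bound FG Suc.prems)
      fix s assume "s \<in> S"
      then have "norm (F v (G (Suc k) s) - F v (G k s)) \<le> L v * (1/2) ^ Suc k"
        using Suc.IH GR by (intro lip) auto
      also have "\<dots> \<le> M * (1/2) ^ Suc k" using LM by (intro mult_right_mono) auto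
      finally show "norm (F v (G (Suc k) s) - F v (G k s)) \<le> M * (1/2) ^ Suc k" .
    qed
    also have "(M * (1/2) ^ Suc k) * \<delta> = (1/2) ^ Suc (Suc k)"
      using \<delta>(2) by (simp add: algebra_simps)
    finally show ?case by (simp only: GS add_diff_cancel_left)
  qed
  have "\<exists>g. uniform_limit S (\<lambda>k t. G k t $ v) g sequentially" for v
  proof -
    have "uniform_limit S (\<lambda>n t. \<Sum>k<n. G (Suc k) t $ v - G k t $ v)
        (\<lambda>t. \<Sum>k. G (Suc k) t $ v - G k t $ v) sequentially"
      using step by (intro Weierstrass_m_test[of _ _ "\<lambda>k. (1/2) ^ Suc k"]) (auto intro!: summable_mult)
    then have "uniform_limit S (\<lambda>n t. z0 $ v + (\<Sum>k<n. G (Suc k) t $ v - G k t $ v))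
        (\<lambda>t. z0 $ v + (\<Sum>k. G (Suc k) t $ v - G k t $ v)) sequentially"
      by (intro uniform_limit_intros)
    then show ?thesis
      by (auto simp: sum_lessThan_telescope[of "\<lambda>k. G k _ $ v"] G0)
  qed
  then obtain g where g: "\<And>v. uniform_limit S (\<lambda>k t. G k t $ v) (g v) sequentially"
    by metis
  define \<gamma> where "\<gamma> t = (\<chi> v. g v t)" for t
  have lim: "(\<lambda>k. G k t $ v) \<longlonglongrightarrow> \<gamma> t $ v" if "t \<in> S" for t v
    using tendsto_uniform_limitI[OF g that, of v] by (simp add: \<gamma>_def)
  have limv: "(\<lambda>k. G k t) \<longlonglongrightarrow> \<gamma> t" if "t \<in> S" for t
    using lim[OF that] by (rule vec_tendstoI)
  have "\<gamma> 0 = z0"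
  proof -
    have "G k 0 = z0" for k
      by (cases k) (simp_all add: G0 GS prim0[OF FG] vec_eq_iff)
    then show ?thesis using limv[OF S(3)] LIMSEQ_unique[of "\<lambda>_. z0"] by auto
  qed
  moreover have "((\<lambda>t. \<gamma> t $ v) has_field_derivative F v (\<gamma> t)) (at t)" if "t \<in> S" for t v
  proof -
    \<comment> \<open>The shifted iterates \<open>G (Suc n)\<close> have derivatives
      \<open>F v (G n x)\<close>. Derivatives of a locally uniform limit of holomorphic functions
      converge as well, which turns the recursion into the differential equation.\<close>
    have "\<exists>g'. \<forall>x\<in>S. (g v has_field_derivative g' x) (at x) \<and> (\<lambda>k. F v (G k x)) \<longlonglongrightarrow> g' x"
    proof (rule has_complex_derivative_uniform_sequence[OF S(1)])
      show "((\<lambda>t. G (Suc n) t $ v) has_field_derivative F v (G n x)) (at x)" if "x \<in> S" for n x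
        unfolding GS using prim[OF FG that] by (auto intro!: derivative_eq_intros)
      show "\<exists>d>0. cball x d \<subseteq> S \<and> uniform_limit (cball x d) (\<lambda>n t. G (Suc n) t $ v) (g v) sequentially"
        if x: "x \<in> S" for x
      proof -
        obtain d where d: "d > 0" "cball x d \<subseteq> S"
          using open_contains_cball S(1) x by blast
        have "uniform_limit S (\<lambda>n t. G (Suc n) t $ v) (g v) sequentially"
          using filterlim_compose[OF g[of v] filterlim_Suc] by simp
        with d show ?thesis by (meson uniform_limit_on_subset)
      qed
    qed
    then obtain g' where "\<forall>x\<in>S. (g v has_field_derivative g' x) (at x) \<and> (\<lambda>k. F v (G k x)) \<longlonglongrightarrow> g' x" ..
    note g' = bspec[OF this that, THEN conjunct1] bspec[OF this that, THEN conjunct2]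
    have "(\<lambda>k. F v (G k t)) \<longlonglongrightarrow> F v (\<gamma> t)"
      by (rule continuous_on_tendsto_compose[OF polyfun_continuous_on[OF F, of UNIV] limv[OF that]]) simp_all
    from LIMSEQ_unique[OF g'(2) this] g'(1) show ?thesis by (simp add: \<gamma>_def)
  qed
  ultimately show ?thesis
    by (intro that[OF \<delta>(1), of \<gamma>]) (simp_all add: S_def)
qed

section \<open>Vector fields preserving a vanishing ideal\<close>

text \<open>Tangent vectors given separately at each point are combined into one field with
  coefficients in \<open>R\<close>. The elimination multiplies through by pivots instead of
  dividing, so its entries stay in the ring \<open>R\<close>.\<close>

lemma tangent_field_exists:
  fixes R :: "('p \<Rightarrow> complex) set" and \<theta> :: "'n::finite \<Rightarrow> ('p \<Rightarrow> complex) \<Rightarrow> 'p \<Rightarrow> complex"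
    and K :: "'p set"
  defines "I \<equiv> {f \<in> R. \<forall>p\<in>K. f p = 0}"
  assumes const: "\<And>c. (\<lambda>_. c) \<in> R"
    and add: "\<And>f g. f \<in> R \<Longrightarrow> g \<in> R \<Longrightarrow> (\<lambda>p. f p + g p) \<in> R"
    and mult: "\<And>f g. f \<in> R \<Longrightarrow> g \<in> R \<Longrightarrow> (\<lambda>p. f p * g p) \<in> R"
    and \<theta>: "\<And>j f. f \<in> R \<Longrightarrow> \<theta> j f \<in> R"
    and "K \<noteq> {}"
    and tangent: "\<And>p. p \<in> K \<Longrightarrow> \<exists>v. v \<noteq> (\<lambda>_. 0) \<and> (\<forall>f\<in>I. (\<Sum>j\<in>UNIV. v j * \<theta> j f p) = 0)"
  obtains X a p where "\<And>j. X j \<in> R" "p \<in> K" "X a p \<noteq> 0"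
    "\<And>f p. f \<in> I \<Longrightarrow> p \<in> K \<Longrightarrow> (\<Sum>j\<in>UNIV. X j p * \<theta> j f p) = 0"
proof -
  have sum: "(\<lambda>p. \<Sum>j\<in>S. f j p) \<in> R" if "\<And>j. f j \<in> R" for f and S :: "'n set"
    using that const add by (induction S rule: infinite_finite_induct) auto
  have diff: "(\<lambda>p. f p - g p) \<in> R" if "f \<in> R" "g \<in> R" for f g
    using add[OF that(1) mult[OF const[of "-1"] that(2)]] by simp
  \<comment> \<open>The rows \<open>c a\<close>, \<open>a \<in> J\<close>, are vector fields in reduced echelon form with pivot \<open>g\<close>, spanning all
    vectors annihilated by \<open>I\<close> wherever \<open>g\<close> does not vanish. If some row did not preserve \<open>I\<close>, an
    elimination step would produce a system with smaller \<open>J\<close>.\<close>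
  define echelon where "echelon J g c \<longleftrightarrow> g \<in> R \<and> (\<forall>a j. c a j \<in> R) \<and> (\<exists>p\<in>K. g p \<noteq> 0) \<and>
     (\<forall>a\<in>J. \<forall>p. c a a p = g p) \<and>
     (\<forall>a\<in>J. \<forall>b\<in>J. \<forall>p. a \<noteq> b \<longrightarrow> c a b p = 0) \<and>
     (\<forall>p\<in>K. \<forall>v. (\<forall>f\<in>I. (\<Sum>j\<in>UNIV. v j * \<theta> j f p) = 0) \<longrightarrow>
        (\<forall>i. g p * v i = (\<Sum>a\<in>J. v a * c a i p)))"
    for J :: "'n set" and g :: "'p \<Rightarrow> complex" and c :: "'n \<Rightarrow> 'n \<Rightarrow> 'p \<Rightarrow> complex"
  define app where "app c a f p = (\<Sum>j\<in>UNIV. c a j p * \<theta> j f p)"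
    for c :: "'n \<Rightarrow> 'n \<Rightarrow> 'p \<Rightarrow> complex" and a f p
  have app_R: "app c a f \<in> R" if "\<And>j. c a j \<in> R" "f \<in> R" for c a f
    unfolding app_def using sum[of "\<lambda>j p. c a j p * \<theta> j f p" UNIV] mult \<theta> that by blast
  have "echelon UNIV (\<lambda>_. 1) (\<lambda>a j _. if a = j then 1 else 0)"
    using const \<open>K \<noteq> {}\<close> unfolding echelon_def
    by (auto simp: if_distrib [of "\<lambda>c. _ * c"] sum.delta cong: if_cong)
  then have "\<exists>J. \<exists>g c. echelon J g c" by blast
  from ex_has_least_nat[of "\<lambda>J. \<exists>g c. echelon J g c" _ card] this
  obtain J g c where J: "echelon J g c" and least: "\<And>J' g' c'. echelon J' g' c' \<Longrightarrow> card J \<le> card J'"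
    by metis
  have cR: "c a j \<in> R" and gR: "g \<in> R" for a j using J by (auto simp: echelon_def)
  obtain p0 where p0: "p0 \<in> K" "g p0 \<noteq> 0" using J by (auto simp: echelon_def)
  have span: "g p * v i = (\<Sum>a\<in>J. v a * c a i p)"
    if "p \<in> K" "\<And>f. f \<in> I \<Longrightarrow> (\<Sum>j\<in>UNIV. v j * \<theta> j f p) = 0" for p v i
    using J that by (auto simp: echelon_def)
  have "J \<noteq> {}"
  proof
    assume "J = {}"
    obtain v where v: "v \<noteq> (\<lambda>_. 0)" "\<forall>f\<in>I. (\<Sum>j\<in>UNIV. v j * \<theta> j f p0) = 0"
      using tangent[OF p0(1)] by blast
    have "g p0 * v i = 0" for i using span[of p0 v i] p0 v(2) \<open>J = {}\<close> by simp
    with p0(2) v(1) show False by (auto simp: fun_eq_iff)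
  qed
  then obtain a where a: "a \<in> J" by blast
  have stable: "g p * app c a f p = 0" if f: "f \<in> I" and a: "a \<in> J" and p: "p \<in> K" for a f p
  proof (rule ccontr)
    assume nz: "g p * app c a f p \<noteq> 0"
    \<comment> \<open>Each row \<open>c' b\<close> is the combination of the rows \<open>c b\<close>
      and \<open>c a\<close> that annihilates \<open>f\<close>; the new pivot \<open>g'\<close> is
      nonzero at the point where \<open>stable\<close> is supposed to fail.\<close>
    define g' where "g' p = app c a f p * g p" for p
    define c' where "c' b j p = app c a f p * c b j p - app c b f p * c a j p" for b j p
    have fR: "f \<in> R" using f by (simp add: I_def)
    have aR: "app c b f \<in> R" for b using app_R[OF cR fR] .
    have "echelon (J - {a}) g' c'"
      unfolding echelon_def
    proof (intro conjI allI ballI impI)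
      show "g' \<in> R" unfolding g'_def[abs_def] using mult aR gR by blast
      show "c' b j \<in> R" for b j
        unfolding c'_def[abs_def] using diff[OF mult[OF aR cR] mult[OF aR cR]] .
      show "\<exists>p\<in>K. g' p \<noteq> 0" using p nz by (auto simp: g'_def)
      show "c' b b p = g' p" if "b \<in> J - {a}" for b p
        using that a J by (auto simp: c'_def g'_def echelon_def)
      show "c' b d p = 0" if "b \<in> J - {a}" "d \<in> J - {a}" "b \<noteq> d" for b d p
        using that a J by (auto simp: c'_def echelon_def)
      fix p v i
      assume p: "p \<in> K" and v: "\<forall>f\<in>I. (\<Sum>j\<in>UNIV. v j * \<theta> j f p) = 0"
      have sp: "g p * v i = (\<Sum>a\<in>J. v a * c a i p)" for i
        using span[OF p, of v i] v by blast
      \<comment> \<open>Testing the expansion of a tangent vector against \<open>f\<close> gives a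
        linear relation between its pivot entries, which eliminates \<open>v a\<close>.\<close>
      have "0 = g p * (\<Sum>j\<in>UNIV. v j * \<theta> j f p)" using v f by simp
      also have "\<dots> = (\<Sum>j\<in>UNIV. (\<Sum>b\<in>J. v b * c b j p) * \<theta> j f p)"
        by (simp add: sum_distrib_left sp[symmetric] mult.assoc)
      also have "\<dots> = (\<Sum>b\<in>J. v b * app c b f p)"
        unfolding app_def sum_distrib_left sum_distrib_right
        by (subst sum.swap) (simp add: mult.assoc)
      also have "\<dots> = v a * app c a f p + (\<Sum>b\<in>J - {a}. v b * app c b f p)"
        by (rule sum.remove) (use a in auto)
      finally have 0: "v a * app c a f p = - (\<Sum>b\<in>J - {a}. v b * app c b f p)"
        by (simp add: add_eq_0_iff2)
      have "g' p * v i = app c a f p * (v a * c a i p + (\<Sum>b\<in>J - {a}. v b * c b i p))"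
        using sp[of i] sum.remove[of J a "\<lambda>b. v b * c b i p"] a
        by (simp add: g'_def mult.assoc)
      also have "\<dots> = (v a * app c a f p) * c a i p + app c a f p * (\<Sum>b\<in>J - {a}. v b * c b i p)"
        by (simp add: algebra_simps)
      also have "\<dots> = (\<Sum>b\<in>J - {a}. v b * c' b i p)"
        unfolding 0 c'_def
        by (simp add: sum_distrib_left sum_distrib_right right_diff_distrib sum_subtractf mult_ac
            flip: sum_negf)
      finally show "g' p * v i = (\<Sum>b\<in>J - {a}. v b * c' b i p)" .
    qed
    from least[OF this] a show False by (metis card_Diff1_less finite_code linorder_not_le)
  qed
  show ?thesis
  \<comment> \<open>The extra factor \<open>g\<close> makes the field annihilate \<open>I\<close> at
    the zeros of \<open>g\<close> too, where the rows alone are not controlled.\<close>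
  proof (rule that[of "\<lambda>j p. g p * c a j p" p0 a])
    show "(\<lambda>p. g p * c a j p) \<in> R" for j using mult gR cR by blast
    show "p0 \<in> K" by fact
    show "g p0 * c a a p0 \<noteq> 0" using p0 a J by (auto simp: echelon_def)
    show "(\<Sum>j\<in>UNIV. (g p * c a j p) * \<theta> j f p) = 0" if "f \<in> I" "p \<in> K" for f p
      using stable[OF that(1) a that(2)] by (simp add: app_def sum_distrib_left mult.assoc)
  qed
qed

section \<open>Critical points in complexified logarithmic coordinates\<close>

text \<open>
  The coordinates \<open>Inl j\<close> stand for \<open>x j\<close> and \<open>Inr j\<close> for \<open>u j = x j powr (q - 1)\<close>; \<open>log_field q j\<close> is the
  derivative with respect to \<open>w j = ln (x j)\<close> under this relation.
\<close>

definition log_field ::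
    "real \<Rightarrow> 'n \<Rightarrow> (complex ^ ('n + 'n) \<Rightarrow> complex) \<Rightarrow> complex ^ ('n::finite + 'n) \<Rightarrow> complex" where
  "log_field q j f z =
     z $ Inl j * partial_deriv (Inl j) f z + of_real (q - 1) * z $ Inr j * partial_deriv (Inr j) f z"

definition exp_point :: "real \<Rightarrow> real ^ 'n \<Rightarrow> complex ^ ('n + 'n)" where
  "exp_point q w = (\<chi> v. case v of Inl j \<Rightarrow> of_real (exp (w $ j))
                              | Inr j \<Rightarrow> of_real (exp ((q - 1) * w $ j)))"

lemma polyfun_log_field: "f \<in> polyfun \<Longrightarrow> log_field q j f \<in> polyfun"
  unfolding log_field_def[abs_def]
  by (intro polyfun.add polyfun.mult polyfun.const polyfun.coord polyfun_partial_deriv)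

lemma sum_UNIV_Plus:
  fixes f :: "'a::finite + 'b::finite \<Rightarrow> 'c::comm_monoid_add"
  shows "(\<Sum>v\<in>UNIV. f v) = (\<Sum>a\<in>UNIV. f (Inl a)) + (\<Sum>b\<in>UNIV. f (Inr b))"
  by (simp add: sum.Plus flip: UNIV_Plus_UNIV)

lemma exp_point_has_derivative:
  fixes w :: "real ^ 'n"
  shows "(exp_point q has_derivative
     (\<lambda>h. \<chi> v. case v of Inl j \<Rightarrow> of_real (exp (w $ j) * h $ j)
        | Inr j \<Rightarrow> of_real (exp ((q - 1) * w $ j) * ((q - 1) * h $ j)))) (at w)"
proof (subst has_derivative_componentwise_within, intro ballI)
  fix i :: "complex ^ ('n + 'n)" assume "i \<in> Basis"
  then obtain v b where i: "i = axis v b"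
    by (auto simp: Basis_vec_def)
  have nth: "((\<lambda>w. w $ j) has_derivative (\<lambda>h. h $ j)) (at w)" for j
    by (rule bounded_linear_imp_has_derivative[OF bounded_linear_vec_nth])
  show "((\<lambda>w. exp_point q w \<bullet> i) has_derivative (\<lambda>h. (\<chi> v. case v of
      Inl j \<Rightarrow> complex_of_real (exp (w $ j) * h $ j)
    | Inr j \<Rightarrow> of_real (exp ((q - 1) * w $ j) * ((q - 1) * h $ j))) \<bullet> i)) (at w)"
  proof (cases v)
    case (Inl j)
    have "((\<lambda>w. complex_of_real (exp (w $ j))) has_derivative
        (\<lambda>h. complex_of_real (exp (w $ j) * h $ j))) (at w)"
      using nth[of j] by (auto intro!: derivative_eq_intros)
    from has_derivative_inner_left[OF this, of b] show ?thesis
      by (simp add: i inner_axis exp_point_def Inl)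
  next
    case (Inr j)
    have "((\<lambda>w. complex_of_real (exp ((q - 1) * w $ j))) has_derivative
        (\<lambda>h. complex_of_real (exp ((q - 1) * w $ j) * ((q - 1) * h $ j)))) (at w)"
      using nth[of j] by (auto intro!: derivative_eq_intros)
    from has_derivative_inner_left[OF this, of b] show ?thesis
      by (simp add: i inner_axis exp_point_def Inr)
  qed
qed

text \<open>This chain rule fixes the factors in \<open>log_field\<close>: it translates real
  directions in \<open>w\<close> into operators on polynomials.\<close>

lemma polyfun_exp_point_has_derivative:
  assumes "f \<in> polyfun"
  shows "((\<lambda>w. f (exp_point q w)) has_derivative
    (\<lambda>h. \<Sum>j\<in>UNIV. of_real (h $ j) * log_field q j f (exp_point q w))) (at w)"
proof -
  have "((\<lambda>w. f (exp_point q w)) has_derivative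
    (\<lambda>h. \<Sum>v\<in>UNIV. partial_deriv v f (exp_point q w) *
       (\<chi> v. case v of Inl j \<Rightarrow> of_real (exp (w $ j) * h $ j)
        | Inr j \<Rightarrow> of_real (exp ((q - 1) * w $ j) * ((q - 1) * h $ j))) $ v)) (at w)"
    using diff_chain_at[OF exp_point_has_derivative polyfun_has_derivative[OF assms]]
    unfolding o_def .
  then show ?thesis
    by (rule has_derivative_eq_rhs)
      (simp add: fun_eq_iff sum_UNIV_Plus log_field_def exp_point_def algebra_simps sum.distrib
        sum_subtractf)
qed

section \<open>Tangent directions and holomorphic flows on the zero set\<close>

text \<open>The direction is a limit of normalized secants, along a subsequence chosen by
  compactness of the sphere before any \<open>F\<close> is given. One \<open>h\<close> therefore
  serves all functions vanishing on \<open>L\<close>.\<close>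

lemma limit_direction:
  fixes L :: "'a::euclidean_space set"
  assumes "w islimpt L"
  obtains h where "h \<noteq> 0"
    "\<And>F D. (F has_derivative D) (at w) \<Longrightarrow> F w = 0 \<Longrightarrow> (\<And>x. x \<in> L \<Longrightarrow> F x = (0::complex)) \<Longrightarrow> D h = 0"
proof -
  obtain x where x: "\<And>n. x n \<in> L - {w}" "x \<longlonglongrightarrow> w"
    using assms by (auto simp: islimpt_sequential)
  define d where "d n = (x n - w) /\<^sub>R norm (x n - w)" for n
  have nz: "norm (x n - w) > 0" for n using x(1)[of n] by auto
  have "d n \<in> sphere 0 1" for n using nz[of n] by (simp add: d_def)
  then obtain h r where h: "h \<in> sphere 0 1" "strict_mono r" "(d \<circ> r) \<longlonglongrightarrow> h"
    using compact_sphere[of "0::'a" 1] unfolding compact_def by metis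
  have xr: "(x \<circ> r) \<longlonglongrightarrow> w" using x(2) h(2) by (rule LIMSEQ_subseq_LIMSEQ)
  show ?thesis
  proof (rule that[of h])
    show "h \<noteq> 0" using h(1) by auto
    fix F :: "'a \<Rightarrow> complex" and D
    assume F: "(F has_derivative D) (at w)" "F w = 0" "\<And>x. x \<in> L \<Longrightarrow> F x = 0"
    have bl: "bounded_linear D" using F(1) by (rule has_derivative_bounded_linear)
    have "((\<lambda>y. ((F y - F w) - D (y - w)) /\<^sub>R norm (y - w)) \<longlongrightarrow> 0) (at w)"
      using F(1) by (simp add: has_derivative_def)
    moreover have "filterlim (x \<circ> r) (at w) sequentially"
      using xr x(1) by (auto simp: filterlim_at)
    ultimately have "(\<lambda>n. ((F (x (r n)) - F w) - D (x (r n) - w)) /\<^sub>R norm (x (r n) - w)) \<longlonglongrightarrow> 0"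
      by (auto dest: filterlim_compose simp: o_def)
    moreover have "((F (x (r n)) - F w) - D (x (r n) - w)) /\<^sub>R norm (x (r n) - w) = - D (d (r n))" for n
      using F(2) F(3)[of "x (r n)"] x(1)[of "r n"] linear_scale[OF bounded_linear.linear[OF bl]]
      by (simp add: d_def)
    ultimately have "(\<lambda>n. - D (d (r n))) \<longlonglongrightarrow> 0"
      by simp
    from tendsto_minus[OF this] have "(\<lambda>n. D (d (r n))) \<longlonglongrightarrow> 0"
      by simp
    moreover have "(\<lambda>n. D (d (r n))) \<longlonglongrightarrow> D h"
      using bounded_linear.tendsto[OF bl h(3)] by (simp add: o_def)
    ultimately show "D h = 0" using LIMSEQ_unique by blast
  qed
qed

text \<open>With \<open>V\<close> a primitive of \<open>X j\<close> along the curve, normalized at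
  0, \<open>x j\<close> is multiplied by \<open>exp V\<close> and \<open>u j\<close> by
  \<open>exp ((q - 1) * V)\<close>. Hence no \<open>x j\<close> reaches 0, and the relation between
  the moduli is conserved; using moduli avoids a branch of the complex power.\<close>

lemma log_field_flow:
  fixes X :: "'n::finite \<Rightarrow> complex ^ ('n + 'n) \<Rightarrow> complex"
  assumes X: "\<And>j. X j \<in> polyfun" and p: "\<And>j. p $ Inl j \<noteq> 0"
  obtains \<delta> \<gamma> where "\<delta> > 0" "\<gamma> 0 = p"
    "\<And>t j. t \<in> ball 0 \<delta> \<Longrightarrow> ((\<lambda>t. \<gamma> t $ Inl j) has_field_derivative \<gamma> t $ Inl j * X j (\<gamma> t)) (at t)"
    "\<And>t j. t \<in> ball 0 \<delta> \<Longrightarrow>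
       ((\<lambda>t. \<gamma> t $ Inr j) has_field_derivative of_real (q - 1) * (\<gamma> t $ Inr j * X j (\<gamma> t))) (at t)"
    "\<And>f t. f \<in> polyfun \<Longrightarrow> t \<in> ball 0 \<delta> \<Longrightarrow>
       ((\<lambda>t. f (\<gamma> t)) has_field_derivative (\<Sum>j\<in>UNIV. X j (\<gamma> t) * log_field q j f (\<gamma> t))) (at t)"
    "\<And>t j. t \<in> ball 0 \<delta> \<Longrightarrow> \<gamma> t $ Inl j \<noteq> 0"
    "\<And>t j. t \<in> ball 0 \<delta> \<Longrightarrow>
       norm (\<gamma> t $ Inr j) * norm (\<gamma> t $ Inl j) powr (1 - q) = norm (p $ Inr j) * norm (p $ Inl j) powr (1 - q)"
proof -
  define F where "F v z = (case v of Inl j \<Rightarrow> z $ Inl j * X j z | Inr j \<Rightarrow> of_real (q - 1) * (z $ Inr j * X j z))"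
    for v :: "'n + 'n" and z
  have FR: "F v \<in> polyfun" for v
    unfolding F_def[abs_def] using X by (cases v) (auto intro!: polyfun.intros(2-4) polyfun.const)
  obtain \<delta> \<gamma> where \<delta>: "\<delta> > 0" and \<gamma>0: "\<gamma> 0 = p"
    and d: "\<And>t v. t \<in> ball 0 \<delta> \<Longrightarrow> ((\<lambda>t. \<gamma> t $ v) has_field_derivative F v (\<gamma> t)) (at t)"
    by (rule polynomial_ode_local_solution[of F p, OF FR]) (rule that)
  note dl = d[of _ "Inl _", unfolded F_def sum.case] and dr = d[of _ "Inr _", unfolded F_def sum.case]
  have df: "((\<lambda>t. f (\<gamma> t)) has_field_derivative (\<Sum>j\<in>UNIV. X j (\<gamma> t) * log_field q j f (\<gamma> t))) (at t)"
    if "f \<in> polyfun" "t \<in> ball 0 \<delta>" for f t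
    using polyfun_along_curve[OF that(1) d[OF that(2)]]
    by (simp add: sum_UNIV_Plus F_def log_field_def algebra_simps sum.distrib sum_subtractf)
  define S where "S = ball (0::complex) \<delta>"
  have S: "convex S" "open S" "0 \<in> S" using \<delta> by (auto simp: S_def)
  have exp_form: "\<exists>V. \<forall>t\<in>S. \<gamma> t $ Inl j = p $ Inl j * exp (V t) \<and>
      \<gamma> t $ Inr j = p $ Inr j * exp (of_real (q - 1) * V t)" for j
  proof -
    have "(\<lambda>t. X j (\<gamma> t)) holomorphic_on S"
      unfolding holomorphic_on_open[OF S(2)] using df[OF X] unfolding S_def by blast
    from holomorphic_convex_primitive'[OF S(1,2) this]
    obtain V where V': "\<And>t. t \<in> S \<Longrightarrow> (V has_field_derivative X j (\<gamma> t)) (at t within S)"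
      by metis
    have V: "(V has_field_derivative X j (\<gamma> t)) (at t)" if "t \<in> S" for t
      using V'[OF that] by (simp only: at_within_open[OF that S(2)])
    have "\<exists>c. \<forall>t\<in>S. \<gamma> t $ Inl j * exp (- V t) = c"
    proof (rule has_field_derivative_zero_constant[OF S(1)])
      fix t assume t: "t \<in> S"
      show "((\<lambda>t. \<gamma> t $ Inl j * exp (- V t)) has_field_derivative 0) (at t within S)"
        by (rule has_field_derivative_at_within[OF DERIV_cong[OF DERIV_mult[OF dl[OF t[unfolded S_def]]
            DERIV_chain2[OF DERIV_exp DERIV_minus[OF V[OF t]]]]]])
          (simp add: mult_ac)
    qed
    then obtain c where c: "\<And>t. t \<in> S \<Longrightarrow> \<gamma> t $ Inl j * exp (- V t) = c" by blast
    have "\<exists>c. \<forall>t\<in>S. \<gamma> t $ Inr j * exp (- (of_real (q - 1) * V t)) = c"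
    proof (rule has_field_derivative_zero_constant[OF S(1)])
      fix t assume t: "t \<in> S"
      show "((\<lambda>t. \<gamma> t $ Inr j * exp (- (of_real (q - 1) * V t))) has_field_derivative 0) (at t within S)"
        by (rule has_field_derivative_at_within[OF DERIV_cong[OF DERIV_mult[OF dr[OF t[unfolded S_def]]
            DERIV_chain2[OF DERIV_exp DERIV_minus[OF DERIV_cmult[OF V[OF t]]]]]]])
          (simp add: mult_ac)
    qed
    then obtain c' where c': "\<And>t. t \<in> S \<Longrightarrow> \<gamma> t $ Inr j * exp (- (of_real (q - 1) * V t)) = c'" by blast
    have "\<gamma> t $ Inl j = p $ Inl j * exp (V t - V 0) \<and>
      \<gamma> t $ Inr j = p $ Inr j * exp (of_real (q - 1) * (V t - V 0))" if t: "t \<in> S" for t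
    proof -
      have *: "a = a0 * exp (b - b0)" if "a * exp (- b) = k" "a0 * exp (- b0) = k" for a a0 b b0 k :: complex
        using that by (auto simp: exp_minus exp_diff field_simps)
      show ?thesis
        using *[OF c[OF t] c[OF S(3)]] *[OF c'[OF t] c'[OF S(3)]]
        by (simp add: \<gamma>0 right_diff_distrib)
    qed
    then show ?thesis by (intro exI[of _ "\<lambda>t. V t - V 0"]) blast
  qed
  have "\<gamma> t $ Inl j \<noteq> 0 \<and>
    norm (\<gamma> t $ Inr j) * norm (\<gamma> t $ Inl j) powr (1 - q) = norm (p $ Inr j) * norm (p $ Inl j) powr (1 - q)"
    if t: "t \<in> S" for t j
  proof -
    obtain V where V: "\<gamma> t $ Inl j = p $ Inl j * exp (V t)"
      "\<gamma> t $ Inr j = p $ Inr j * exp (of_real (q - 1) * V t)"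
      using exp_form[of j] t by blast
    have "exp ((q - 1) * Re (V t)) * exp (Re (V t)) powr (1 - q) = 1"
      by (simp add: powr_def mult_exp_exp algebra_simps)
    then show ?thesis using p[of j]
      unfolding V by (simp add: norm_mult powr_mult mult_ac)
  qed
  then show ?thesis
    using that[OF \<delta> \<gamma>0 dl dr df] by (simp add: S_def)
qed

text \<open>All derivatives of \<open>f (\<gamma> t)\<close> at 0 are values at
  \<open>\<gamma> 0\<close> of members of \<open>I\<close>, hence zero, and the identity theorem for
  holomorphic functions applies.\<close>

lemma invariant_set_vanishes_on_flow:
  assumes d: "\<And>f t. f \<in> I \<Longrightarrow> t \<in> ball 0 \<delta> \<Longrightarrow> ((\<lambda>t. f (\<gamma> t)) has_field_derivative D f (\<gamma> t)) (at t)"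
    and D: "\<And>f. f \<in> I \<Longrightarrow> D f \<in> I"
    and zero: "\<And>f. f \<in> I \<Longrightarrow> f (\<gamma> 0) = (0::complex)"
    and f: "f \<in> I" and t: "t \<in> ball 0 \<delta>"
  shows "f (\<gamma> t) = 0"
proof -
  have der: "\<exists>g\<in>I. \<forall>t\<in>ball 0 \<delta>. (deriv ^^ n) (\<lambda>t. f (\<gamma> t)) t = g (\<gamma> t)" for n
  proof (induction n)
    case (Suc n)
    then obtain g where g: "g \<in> I" "\<And>t. t \<in> ball 0 \<delta> \<Longrightarrow> (deriv ^^ n) (\<lambda>t. f (\<gamma> t)) t = g (\<gamma> t)"
      by blast
    have "deriv ((deriv ^^ n) (\<lambda>t. f (\<gamma> t))) t = D g (\<gamma> t)" if t: "t \<in> ball 0 \<delta>" for t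
    proof -
      have "((deriv ^^ n) (\<lambda>t. f (\<gamma> t)) has_field_derivative D g (\<gamma> t)) (at t)"
        by (rule has_field_derivative_transform_within_open[OF d[OF g(1) t] open_ball t])
          (simp add: g(2))
      then show ?thesis by (rule DERIV_imp_deriv)
    qed
    then show ?case using D[OF g(1)] by auto
  qed (use f in auto)
  have "(0::complex) \<in> ball 0 \<delta>" using t by (auto intro: le_less_trans[OF norm_ge_zero])
  moreover have "(deriv ^^ n) (\<lambda>t. f (\<gamma> t)) 0 = 0" for n
    using der[of n] zero calculation by auto
  moreover have "(\<lambda>t. f (\<gamma> t)) holomorphic_on ball 0 \<delta>"
    unfolding holomorphic_on_open[OF open_ball] using d[OF f] by blast
  ultimately show ?thesis
    using holomorphic_fun_eq_0_on_connected[OF _ open_ball connected_ball _ _ t] by blast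
qed

section \<open>A priori bounds on solutions of the critical equations\<close>

lemma gram_equation_bound:
  fixes A :: "real ^ 'n ^ 'm" and s :: real
  assumes "s > 0"
  obtains B where
    "\<And>a d. transpose A *v (A *v a) + s *\<^sub>R d = b \<Longrightarrow> (\<And>i. \<bar>a $ i\<bar> \<le> 1 \<or> \<bar>d $ i\<bar> \<le> 1) \<Longrightarrow> norm d \<le> B"
proof -
  define P where "P J v = (\<chi> i. if i \<in> J then v $ i else 0)" for J and v :: "real ^ 'n"
  have P_add: "P J (v + w) = P J v + P J w" and P_scale: "P J (c *\<^sub>R v) = c *\<^sub>R P J v" for J v w c
    by (simp_all add: P_def vec_eq_iff)
  have P_norm: "norm (P J v) \<le> norm v" for J v
    unfolding norm_vec_def by (intro L2_set_mono) (auto simp: P_def)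
  have P_lin: "linear (P J)" for J by (rule linearI) (simp_all add: P_add P_scale)
  \<comment> \<open>\<open>P J \<circ> transpose A\<close> is injective on the range of \<open>A \<circ> P J\<close>, since \<open>A (P J v) \<bullet> A (P J v) =
    P J v \<bullet> P J (transpose A (A (P J v)))\<close>. With \<open>J\<close> the set of large entries of \<open>a\<close> this bounds \<open>A a\<close>,
    although \<open>a\<close> itself may be unbounded.\<close>
  have iso: "\<exists>c>0. \<forall>v. norm (P J (transpose A *v (A *v P J v))) \<ge> c * norm (A *v P J v)" for J
  proof -
    define V where "V = range (\<lambda>v. A *v P J v)"
    have sub: "subspace V"
      unfolding V_def
      using linear_subspace_image[OF linear_compose[OF P_lin matrix_vector_mul_linear] subspace_UNIV]
      by (simp add: o_def)
    have "\<exists>e>0. \<forall>x\<in>V. e * norm x \<le> norm (P J (transpose A *v x))"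
    proof (rule injective_imp_isometric[OF closed_subspace[OF sub] sub])
      show "bounded_linear (\<lambda>x. P J (transpose A *v x))"
        using bounded_linear_compose[OF _ matrix_vector_mul_bounded_linear] P_lin linear_linear by blast
      show "\<forall>x\<in>V. P J (transpose A *v x) = 0 \<longrightarrow> x = 0"
      proof (intro ballI impI)
        fix x assume "x \<in> V" and 0: "P J (transpose A *v x) = 0"
        then obtain v where x: "x = A *v P J v" by (auto simp: V_def)
        have "x \<bullet> (A *v P J v) = P J v \<bullet> (transpose A *v x)"
          by (simp add: transpose_matrix_vector dot_lmul_matrix inner_commute[of "P J v"])
        then have "x \<bullet> x = P J v \<bullet> (transpose A *v x)"
          by (simp only: x[symmetric])
        also have "\<dots> = P J v \<bullet> P J (transpose A *v x)"
          unfolding inner_vec_def by (intro sum.cong) (auto simp: P_def)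
        finally have "x \<bullet> x = 0" unfolding 0 by simp
        then show "x = 0" by simp
      qed
    qed
    then show ?thesis by (auto simp: V_def)
  qed
  then obtain c where c: "\<And>J. c J > 0"
    "\<And>J v. norm (P J (transpose A *v (A *v P J v))) \<ge> c J * norm (A *v P J v)"
    by metis
  obtain K where K: "K > 0" "\<And>v. norm (A *v v) \<le> norm v * K"
    using bounded_linear.pos_bounded[OF matrix_vector_mul_bounded_linear[of A]] by blast
  obtain T where T: "T > 0" "\<And>v. norm (transpose A *v v) \<le> norm v * T"
    using bounded_linear.pos_bounded[OF matrix_vector_mul_bounded_linear[of "transpose A"]] by blast
  define n where "n = real CARD('n)"
  define N0 where "N0 = norm b + s * n + n * K * T"
  \<comment> \<open>The set \<open>J\<close> will depend on the solution; summing over all index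
    sets makes the bound on \<open>norm (A *v P J a)\<close> uniform.\<close>
  define B where "B = (norm b + ((\<Sum>J\<in>UNIV. N0 / c J) + n * K) * T) / s"
  have small: "norm v \<le> n" if "\<And>i. \<bar>v $ i\<bar> \<le> 1" for v :: "real ^ 'n"
  proof -
    have "norm v \<le> (\<Sum>i\<in>UNIV. \<bar>v $ i\<bar>)" by (rule norm_le_l1_cart)
    also have "\<dots> \<le> n" using sum_bounded_above[of UNIV "\<lambda>i. \<bar>v $ i\<bar>" 1] that by (simp add: n_def)
    finally show ?thesis .
  qed
  have N0: "N0 \<ge> 0" using K T \<open>s > 0\<close> by (simp add: N0_def n_def)
  show ?thesis
  proof (rule that[of B])
    fix a d assume eq: "transpose A *v (A *v a) + s *\<^sub>R d = b"
      and ad: "\<And>i. \<bar>a $ i\<bar> \<le> 1 \<or> \<bar>d $ i\<bar> \<le> 1"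
    \<comment> \<open>On \<open>J\<close> the entries of \<open>d\<close> are at most 1 in modulus
      by hypothesis, and off \<open>J\<close> those of \<open>a\<close> are, so only
      \<open>P J a\<close> is uncontrolled.\<close>
    define J where "J = {i. \<bar>a $ i\<bar> > 1}"
    have a: "a = P J a + P (- J) a" by (auto simp: P_def vec_eq_iff)
    have PC: "norm (P (- J) a) \<le> n" by (rule small) (auto simp: P_def J_def)
    have Pd: "norm (P J d) \<le> n" using ad by (intro small) (force simp: P_def J_def)
    have AC: "norm (A *v P (- J) a) \<le> n * K"
      using K(2)[of "P (- J) a"] mult_right_mono[OF PC, of K] K(1) by linarith
    have "P J (transpose A *v (A *v P J a)) = P J b - s *\<^sub>R P J d - P J (transpose A *v (A *v P (- J) a))"
    proof -
      have "P J b = P J (transpose A *v (A *v (P J a + P (- J) a))) + s *\<^sub>R P J d"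
        unfolding a[symmetric] eq[symmetric] P_add P_scale ..
      then show ?thesis by (simp add: matrix_vector_right_distrib P_add)
    qed
    also have "norm \<dots> \<le> norm (P J b) + s * norm (P J d) + norm (P J (transpose A *v (A *v P (- J) a)))"
      using norm_triangle_ineq4[of "P J b - s *\<^sub>R P J d" "P J (transpose A *v (A *v P (- J) a))"]
        norm_triangle_ineq4[of "P J b" "s *\<^sub>R P J d"] \<open>s > 0\<close> by simp
    also have "\<dots> \<le> norm b + s * n + n * K * T"
    proof (intro add_mono mult_left_mono)
      show "norm (P J (transpose A *v (A *v P (- J) a))) \<le> n * K * T"
        using P_norm[of J "transpose A *v (A *v P (- J) a)"] T(2)[of "A *v P (- J) a"]
          mult_right_mono[OF AC, of T] T(1) by linarith
    qed (use P_norm Pd \<open>s > 0\<close> in auto)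
    finally have "c J * norm (A *v P J a) \<le> N0" using c(2)[of J a] by (simp add: N0_def)
    then have "norm (A *v P J a) \<le> N0 / c J" using c(1)[of J] by (simp add: pos_le_divide_eq mult.commute)
    also have "\<dots> \<le> (\<Sum>J\<in>UNIV. N0 / c J)"
      by (rule member_le_sum) (use N0 c(1) in \<open>auto simp: less_imp_le\<close>)
    finally have "norm (A *v a) \<le> (\<Sum>J\<in>UNIV. N0 / c J) + n * K"
      using norm_triangle_ineq[of "A *v P J a" "A *v P (- J) a"] AC
      by (subst a) (simp add: matrix_vector_right_distrib)
    from mult_right_mono[OF this, of T] T(1) T(2)[of "A *v a"]
    have "norm (transpose A *v (A *v a)) \<le> ((\<Sum>J\<in>UNIV. N0 / c J) + n * K) * T"
      by linarith
    moreover have "s * norm d \<le> norm b + norm (transpose A *v (A *v a))"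
    proof -
      have "s *\<^sub>R d = b - transpose A *v (A *v a)" using eq by (simp add: algebra_simps)
      then have "norm (s *\<^sub>R d) \<le> norm b + norm (transpose A *v (A *v a))"
        by (simp add: norm_triangle_ineq4)
      then show ?thesis using \<open>s > 0\<close> by simp
    qed
    ultimately show "norm d \<le> B"
      using \<open>s > 0\<close> by (simp add: B_def pos_le_divide_eq mult.commute)
  qed
qed

definition complex_critical ::
    "real ^ 'n ^ 'm \<Rightarrow> real ^ 'n \<Rightarrow> real \<Rightarrow> 'n \<Rightarrow> complex ^ ('n + 'n) \<Rightarrow> complex" where
  "complex_critical A b s i z =
     (\<Sum>k\<in>UNIV. of_real ((transpose A ** A) $ i $ k) * z $ Inl k) + of_real s * z $ Inr i + of_real (- b $ i)"

lemma polyfun_complex_critical: "complex_critical A b s i \<in> polyfun"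
  unfolding complex_critical_def[abs_def]
  by (intro polyfun.add polyfun.mult polyfun.const polyfun.coord polyfun_sum)

lemma complex_critical_exp_point:
  "complex_critical A b s i (exp_point q w) = of_real
     ((transpose A *v (A *v (\<chi> k. exp (w $ k)))) $ i + s * exp ((q - 1) * w $ i) - b $ i)"
  by (simp add: complex_critical_def exp_point_def matrix_vector_mul_assoc)
    (simp add: matrix_vector_mult_def)

text \<open>The coefficients are real, so the real and imaginary parts of a solution solve real
  equations of the same kind, with right-hand sides \<open>b\<close> and 0.\<close>

lemma complex_critical_bound:
  fixes A :: "real ^ 'n ^ 'm" and s :: real
  assumes "s > 0"
  obtains M where "M \<ge> 1"
    "\<And>z j. (\<And>i. complex_critical A b s i z = 0) \<Longrightarrow> (\<And>i. norm (z $ Inl i) \<le> 1 \<or> norm (z $ Inr i) \<le> 1) \<Longrightarrow>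
       norm (z $ Inr j) \<le> M"
proof -
  obtain B1 where B1: "\<And>a d. transpose A *v (A *v a) + s *\<^sub>R d = b \<Longrightarrow>
      (\<And>i. \<bar>a $ i\<bar> \<le> 1 \<or> \<bar>d $ i\<bar> \<le> 1) \<Longrightarrow> norm d \<le> B1"
    using gram_equation_bound[OF assms] by metis
  obtain B2 where B2: "\<And>a d. transpose A *v (A *v a) + s *\<^sub>R d = 0 \<Longrightarrow>
      (\<And>i. \<bar>a $ i\<bar> \<le> 1 \<or> \<bar>d $ i\<bar> \<le> 1) \<Longrightarrow> norm d \<le> B2"
    using gram_equation_bound[OF assms] by metis
  show ?thesis
  proof (rule that[of "max 1 (B1 + B2)"])
    fix z j assume eq: "\<And>i. complex_critical A b s i z = 0"
      and z: "\<And>i. norm (z $ Inl i) \<le> 1 \<or> norm (z $ Inr i) \<le> 1"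
    have "norm (\<chi> i. Re (z $ Inr i)) \<le> B1"
    proof (rule B1[of "\<chi> i. Re (z $ Inl i)"])
      show "transpose A *v (A *v (\<chi> i. Re (z $ Inl i))) + s *\<^sub>R (\<chi> i. Re (z $ Inr i)) = b"
        using arg_cong[OF eq, of Re]
        by (simp add: vec_eq_iff matrix_vector_mul_assoc)
          (simp add: complex_critical_def matrix_vector_mult_def)
    qed (use z abs_Re_le_cmod order_trans in \<open>auto; blast\<close>)
    moreover have "norm (\<chi> i. Im (z $ Inr i)) \<le> B2"
    proof (rule B2[of "\<chi> i. Im (z $ Inl i)"])
      show "transpose A *v (A *v (\<chi> i. Im (z $ Inl i))) + s *\<^sub>R (\<chi> i. Im (z $ Inr i)) = 0"
        using arg_cong[OF eq, of Im]
        by (simp add: vec_eq_iff matrix_vector_mul_assoc)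
          (simp add: complex_critical_def matrix_vector_mult_def)
    qed (use z abs_Im_le_cmod order_trans in \<open>auto; blast\<close>)
    moreover have "\<bar>Re (z $ Inr j)\<bar> \<le> norm (\<chi> i. Re (z $ Inr i))" "\<bar>Im (z $ Inr j)\<bar> \<le> norm (\<chi> i. Im (z $ Inr i))"
      using component_le_norm_cart[of "\<chi> i. Re (z $ Inr i)" j] component_le_norm_cart[of "\<chi> i. Im (z $ Inr i)" j]
      by simp_all
    ultimately show "norm (z $ Inr j) \<le> max 1 (B1 + B2)"
      using cmod_le[of "z $ Inr j"] by linarith
  qed simp
qed

section \<open>A weight that attains its maximum on the zero set\<close>

definition weight :: "nat \<Rightarrow> (complex ^ ('n + 'n) \<Rightarrow> complex) \<Rightarrow> complex ^ ('n::finite + 'n) \<Rightarrow> real" where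
  "weight k h z = norm (h z) * (\<Prod>j\<in>UNIV. inverse (norm (z $ Inl j)) ^ k) * exp (\<Sum>j\<in>UNIV. (norm (z $ Inr j))\<^sup>2)"

text \<open>\<open>k\<close> exceeds the growth exponent \<open>d\<close> of \<open>h\<close> by
  one. If \<open>X\<close> is the largest modulus among the \<open>z $ Inl j\<close>, the factor
  \<open>inverse X ^ k\<close> beats the growth \<open>X ^ d\<close> of \<open>h\<close> by one
  power; the other factors are bounded because \<open>m\<close> keeps their coordinates away from
  0.\<close>

lemma weight_decay:
  fixes h :: "complex ^ ('n::finite + 'n) \<Rightarrow> complex"
  assumes "h \<in> polyfun" and m: "0 < m" and M: "0 \<le> M"
  obtains k Q where "\<And>z i. (\<And>j. m \<le> norm (z $ Inl j)) \<Longrightarrow> (\<And>j. norm (z $ Inr j) \<le> M) \<Longrightarrow>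
    norm (z $ Inl i) * weight k h z \<le> Q"
proof -
  obtain C d where C: "C \<ge> 0" "\<And>z. norm (h z) \<le> C * (1 + norm z) ^ d"
    using polyfun_growth[OF assms(1)] by metis
  define n where "n = CARD('n)"
  \<comment> \<open>As \<open>X \<ge> m\<close>, the constant part of the bound on
    \<open>1 + norm z\<close> is absorbed into a multiple of \<open>X\<close>, giving
    \<open>1 + norm z \<le> G * X\<close>. \<open>Em\<close> bounds the other \<open>n - 1\<close>
    factors of the product.\<close>
  define G where "G = (1 + n * M) / m + n"
  define Em where "Em = (inverse m ^ Suc d) ^ (n - 1)"
  define Ex where "Ex = exp (n * M\<^sup>2)"
  have pos: "G \<ge> 0" "Em \<ge> 0" "Ex \<ge> 0" using m M by (auto simp: G_def Em_def Ex_def)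
  show ?thesis
  proof (rule that[of "Suc d" "C * G ^ d * Em * Ex"])
    fix z :: "complex ^ ('n + 'n)" and i
    assume x: "\<And>j. m \<le> norm (z $ Inl j)" and u: "\<And>j. norm (z $ Inr j) \<le> M"
    have wpos: "weight (Suc d) h z \<ge> 0" by (auto simp: weight_def intro!: mult_nonneg_nonneg prod_nonneg)
    define f where "f j = norm (z $ Inl j)" for j
    have "Max (range f) \<in> range f" by (rule Max_in) auto
    then obtain i0 where "Max (range f) = f i0" by (rule rangeE)
    then have i0: "norm (z $ Inl j) \<le> norm (z $ Inl i0)" for j
      using Max_ge[of "range f" "f j"] by (simp add: f_def)
    define X where "X = norm (z $ Inl i0)"
    have X: "X \<ge> m" "X > 0" using x[of i0] m by (auto simp: X_def)
    have "norm z \<le> (\<Sum>v\<in>UNIV. norm (z $ v))"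
      unfolding norm_vec_def by (rule L2_set_le_sum) auto
    also have "\<dots> \<le> n * X + n * M"
      unfolding sum_UNIV_Plus n_def X_def
      using i0 u by (intro add_mono order_trans[OF sum_bounded_above]) auto
    finally have "1 + norm z \<le> (1 + n * M) + n * X" by simp
    also have "1 + n * M \<le> (1 + n * M) / m * X"
      using mult_left_mono[OF X(1), of "(1 + n * M) / m"] m M by simp
    finally have "1 + norm z \<le> G * X" by (simp add: G_def algebra_simps)
    then have "(1 + norm z) ^ d \<le> (G * X) ^ d" by (intro power_mono) auto
    then have h: "norm (h z) \<le> C * (G * X) ^ d"
      using C(2)[of z] mult_left_mono[OF _ C(1)] order_trans by blast
    have "(\<Prod>j\<in>UNIV. inverse (norm (z $ Inl j)) ^ Suc d) =
        inverse X ^ Suc d * (\<Prod>j\<in>UNIV - {i0}. inverse (norm (z $ Inl j)) ^ Suc d)"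
      unfolding X_def by (rule prod.remove) auto
    also have "\<dots> \<le> inverse X ^ Suc d * (\<Prod>j\<in>UNIV - {i0}. inverse m ^ Suc d)"
      using x m X by (intro mult_left_mono prod_mono conjI power_mono le_imp_inverse_le) auto
    also have "(\<Prod>j\<in>UNIV - {i0}. inverse m ^ Suc d) = Em" by (simp add: Em_def n_def)
    finally have p: "(\<Prod>j\<in>UNIV. inverse (norm (z $ Inl j)) ^ Suc d) \<le> inverse X ^ Suc d * Em" .
    have "(\<Sum>j\<in>UNIV. (norm (z $ Inr j))\<^sup>2) \<le> n * M\<^sup>2"
      using sum_bounded_above[of UNIV "\<lambda>j. (norm (z $ Inr j))\<^sup>2" "M\<^sup>2"] u
      by (simp add: n_def power_mono)
    then have e: "exp (\<Sum>j\<in>UNIV. (norm (z $ Inr j))\<^sup>2) \<le> Ex" by (simp add: Ex_def)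
    have "weight (Suc d) h z \<le> (C * (G * X) ^ d) * (inverse X ^ Suc d * Em) * Ex"
      unfolding weight_def using h p e pos X C
      by (intro mult_mono) (auto intro!: prod_nonneg mult_nonneg_nonneg)
    also have "\<dots> = (C * G ^ d * Em * Ex) * (X ^ d * inverse X ^ Suc d)"
      by (simp add: power_mult_distrib mult_ac)
    also have "X ^ d * inverse X ^ Suc d = inverse X"
      using X by (simp add: power_inverse field_simps)
    finally have "X * weight (Suc d) h z \<le> C * G ^ d * Em * Ex"
      using X by (simp add: field_simps)
    then show "norm (z $ Inl i) * weight (Suc d) h z \<le> C * G ^ d * Em * Ex"
      using mult_right_mono[OF i0[of i] wpos] unfolding X_def by linarith
  qed
qed

text \<open>\<open>W\<close> may be unbounded, but the decay of the weight makes its superlevel set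
  through \<open>p\<close> compact.\<close>

lemma weight_attains_max:
  fixes h :: "complex ^ ('n::finite + 'n) \<Rightarrow> complex"
  assumes I: "I \<subseteq> polyfun" and q: "q < 1" and h: "h \<in> polyfun" and M: "M \<ge> 1"
  defines "W \<equiv> {z. (\<forall>f\<in>I. f z = 0) \<and> (\<forall>j. z $ Inl j \<noteq> 0) \<and>
                   (\<forall>j. norm (z $ Inr j) * norm (z $ Inl j) powr (1 - q) = 1)}"
  assumes u: "\<And>z j. z \<in> W \<Longrightarrow> norm (z $ Inr j) \<le> M"
    and p: "p \<in> W" "h p \<noteq> 0"
  obtains k zmax where "zmax \<in> W" "h zmax \<noteq> 0" "\<And>z. z \<in> W \<Longrightarrow> weight k h z \<le> weight k h zmax"
proof -
  \<comment> \<open>The modulus relation turns the upper bound \<open>M\<close> on the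
    \<open>u\<close> coordinates into a lower bound on the \<open>x\<close> coordinates.\<close>
  define m where "m = (1 / M) powr (1 / (1 - q))"
  have m: "m > 0" using M by (simp add: m_def)
  have x: "m \<le> norm (z $ Inl j)" if z: "z \<in> W" for z j
  proof -
    define X where "X = norm (z $ Inl j)"
    have X: "X > 0" "norm (z $ Inr j) * X powr (1 - q) = 1" using z by (auto simp: W_def X_def)
    have "1 \<le> M * X powr (1 - q)"
      using mult_right_mono[OF u[OF z, of j], of "X powr (1 - q)"] X(2) by simp
    then have "1 / M \<le> X powr (1 - q)" using M by (simp add: pos_divide_le_eq mult.commute)
    then have "m \<le> (X powr (1 - q)) powr (1 / (1 - q))"
      unfolding m_def using q M by (intro powr_mono2) auto
    also have "\<dots> = X" using X q by (simp add: powr_powr)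
    finally show ?thesis by (simp add: X_def)
  qed
  obtain k Q where Q: "\<And>z i. (\<And>j. m \<le> norm (z $ Inl j)) \<Longrightarrow> (\<And>j. norm (z $ Inr j) \<le> M) \<Longrightarrow>
    norm (z $ Inl i) * weight k h z \<le> Q"
    by (rule weight_decay[OF h m order_trans[OF zero_le_one M]]) (rule that, blast)
  define c where "c = weight k h p"
  have c: "c > 0" using p by (auto simp: c_def weight_def W_def intro!: mult_pos_pos prod_pos)
  \<comment> \<open>The condition \<open>z $ Inl j \<noteq> 0\<close> is not closed; on
    \<open>W\<close> it is replaced by membership in the closed set \<open>D\<close>, where the
    weight is continuous.\<close>
  define D where "D = {z :: complex ^ ('n + 'n). \<forall>j. m \<le> norm (z $ Inl j)}"
  have D: "closed D"
    unfolding D_def by (intro closed_Collect_all closed_Collect_le continuous_intros)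
  have nz: "z $ Inl j \<noteq> 0" if "z \<in> D" for z j
  proof -
    have "m \<le> norm (z $ Inl j)" using that by (simp add: D_def)
    then show ?thesis using m by auto
  qed
  have cont: "continuous_on D (weight k h)"
    unfolding weight_def[abs_def]
    by (intro continuous_intros continuous_on_norm polyfun_continuous_on h) (use nz in auto)
  have contg: "continuous_on D (\<lambda>z. norm (z $ Inr j) * norm (z $ Inl j) powr (1 - q))" for j
    by (intro continuous_intros) (use nz in auto)
  define W0 where "W0 = {z \<in> W. c \<le> weight k h z}"
  have W0_eq: "W0 = (\<Inter>f\<in>I. {z. f z = 0}) \<inter>
      (\<Inter>j. D \<inter> (\<lambda>z. norm (z $ Inr j) * norm (z $ Inl j) powr (1 - q)) -` {1}) \<inter>
      (D \<inter> weight k h -` {c..})"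
    using x nz by (auto simp: W0_def W_def D_def)
  have "closed W0"
    unfolding W0_eq
  proof (intro closed_Int[of "_ \<inter> _"] closed_Int[of "\<Inter>_"] closed_INT ballI)
    fix f assume "f \<in> I"
    then show "closed {z. f z = 0}"
      using I by (intro closed_Collect_eq continuous_on_const polyfun_continuous_on) auto
  qed (rule continuous_closed_preimage[OF contg D closed_singleton]
      continuous_closed_preimage[OF cont D closed_atLeast])+
  moreover have "bounded W0"
  proof (rule boundedI)
    fix z assume z: "z \<in> W0"
    have "norm (z $ v) \<le> max (Q / c) M" for v
    proof (cases v)
      case (Inl i)
      have "norm (z $ Inl i) * c \<le> norm (z $ Inl i) * weight k h z"
        using z by (intro mult_left_mono) (auto simp: W0_def)
      also have "\<dots> \<le> Q" using z x u by (intro Q) (auto simp: W0_def)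
      finally have "norm (z $ Inl i) \<le> Q / c" using c by (simp add: pos_le_divide_eq)
      then show ?thesis by (simp add: Inl)
    next
      case (Inr i)
      then show ?thesis using u[of z i] z by (simp add: W0_def le_max_iff_disj)
    qed
    then have "(\<Sum>v\<in>UNIV. norm (z $ v)) \<le> CARD('n + 'n) * max (Q / c) M"
      using sum_bounded_above[of UNIV "\<lambda>v. norm (z $ v)"] by simp
    moreover have "norm z \<le> (\<Sum>v\<in>UNIV. norm (z $ v))"
      unfolding norm_vec_def by (rule L2_set_le_sum) auto
    ultimately show "norm z \<le> CARD('n + 'n) * max (Q / c) M" by linarith
  qed
  ultimately have "compact W0" by (simp add: compact_eq_bounded_closed)
  moreover have "p \<in> W0" using p by (simp add: W0_def c_def)
  moreover have "continuous_on W0 (weight k h)"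
    by (rule continuous_on_subset[OF cont]) (auto simp: W0_eq)
  ultimately obtain zmax where zmax: "zmax \<in> W0" "\<And>z. z \<in> W0 \<Longrightarrow> weight k h z \<le> weight k h zmax"
    using continuous_attains_sup[of W0 "weight k h"] by auto
  show ?thesis
  proof (rule that[of zmax k])
    show "zmax \<in> W" "h zmax \<noteq> 0" using zmax(1) c by (auto simp: W0_def weight_def)
    show "weight k h z \<le> weight k h zmax" if "z \<in> W" for z
      using that zmax by (cases "c \<le> weight k h z") (auto simp: W0_def)
  qed
qed

section \<open>The maximum principle on a connected set of critical points\<close>

text \<open>Multiplied by \<open>exp (w $ i)\<close> and with \<open>x = exp w\<close>, the equation
  says for \<open>q \<noteq> 0\<close> that the gradient in \<open>w\<close> of \<open>(norm (A *v
  x))\<^sup>2 / 2 - b \<bullet> x + (s / q) * (\<Sum>i. x i powr q)\<close> vanishes.\<close>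

theorem exp_gram_critical_set_scattered:
  fixes A :: "real ^ 'n ^ 'm" and b :: "real ^ 'n" and L :: "(real ^ 'n) set"
  assumes s: "s > 0" and q: "q < 1" and L: "connected L"
    and crit: "\<And>w i. w \<in> L \<Longrightarrow>
      (transpose A *v (A *v (\<chi> k. exp (w $ k)))) $ i + s * exp ((q - 1) * w $ i) = b $ i"
    and w: "w1 \<in> L" "w2 \<in> L"
  shows "w1 = w2"
proof (rule ccontr)
  assume "w1 \<noteq> w2"
  then have limpt: "w islimpt L" if "w \<in> L" for w
    using connected_imp_perfect[OF L that] w by auto
  define K where "K = exp_point q ` L"
  define I where "I = {f \<in> polyfun. \<forall>p\<in>K. f p = 0}"
  have tangent: "\<exists>v. v \<noteq> (\<lambda>_. 0) \<and> (\<forall>f\<in>I. (\<Sum>j\<in>UNIV. v j * log_field q j f p) = 0)" if p: "p \<in> K" for p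
  proof -
    obtain x where x: "x \<in> L" "p = exp_point q x" using p by (auto simp: K_def)
    obtain v where "v \<noteq> 0" and
      v: "\<And>F D. (F has_derivative D) (at x) \<Longrightarrow> F x = 0 \<Longrightarrow> (\<And>x. x \<in> L \<Longrightarrow> F x = (0::complex)) \<Longrightarrow> D v = 0"
      by (rule limit_direction[OF limpt[OF x(1)]]) (erule that, blast)
    show ?thesis
    proof (intro exI[of _ "\<lambda>j. complex_of_real (v $ j)"] conjI ballI)
      show "(\<lambda>j. complex_of_real (v $ j)) \<noteq> (\<lambda>_. 0)"
        using \<open>v \<noteq> 0\<close> by (auto simp: fun_eq_iff vec_eq_iff)
      fix f assume "f \<in> I"
      then have f: "f \<in> polyfun" "\<And>y. y \<in> L \<Longrightarrow> f (exp_point q y) = 0" by (auto simp: I_def K_def)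
      show "(\<Sum>j\<in>UNIV. complex_of_real (v $ j) * log_field q j f p) = 0"
        using v[OF polyfun_exp_point_has_derivative[OF f(1)] f(2)[OF x(1)] f(2)] by (simp add: x(2))
    qed
  qed
  have "K \<noteq> {}" using w(1) by (auto simp: K_def)
  obtain X a p where X: "\<And>j. X j \<in> polyfun" and p: "p \<in> K" "X a p \<noteq> 0"
    and tang: "\<And>f p. f \<in> I \<Longrightarrow> p \<in> K \<Longrightarrow> (\<Sum>j\<in>UNIV. X j p * log_field q j f p) = 0"
    by (rule tangent_field_exists[of polyfun "log_field q" K, OF polyfun.const polyfun.add polyfun.mult
          polyfun_log_field \<open>K \<noteq> {}\<close> tangent[unfolded I_def]])
      (auto simp: I_def)
  define W where "W = {z. (\<forall>f\<in>I. f z = 0) \<and> (\<forall>j. z $ Inl j \<noteq> 0) \<and>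
                   (\<forall>j. norm (z $ Inr j) * norm (z $ Inl j) powr (1 - q) = 1)}"
  have KW: "K \<subseteq> W"
    by (auto simp: K_def W_def I_def exp_point_def norm_mult powr_def mult_exp_exp algebra_simps)
  have crit_I: "complex_critical A b s i \<in> I" for i
    using crit by (auto simp: I_def K_def polyfun_complex_critical complex_critical_exp_point simp del: of_real_add of_real_diff)
  obtain M where M: "M \<ge> 1" and
    bound: "\<And>z j. (\<And>i. complex_critical A b s i z = 0) \<Longrightarrow> (\<And>i. norm (z $ Inl i) \<le> 1 \<or> norm (z $ Inr i) \<le> 1) \<Longrightarrow>
       norm (z $ Inr j) \<le> M"
    by (rule complex_critical_bound[OF s, of A b]) (rule that, assumption, blast)
  have WM: "norm (z $ Inr j) \<le> M" if z: "z \<in> W" for z j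
  proof (rule bound)
    show "complex_critical A b s i z = 0" for i using z crit_I by (auto simp: W_def)
    \<comment> \<open>Two factors with product 1 cannot both exceed 1; this gives the alternative on
      which the a priori bound rests.\<close>
    show "norm (z $ Inl i) \<le> 1 \<or> norm (z $ Inr i) \<le> 1" for i
    proof (rule disjCI)
      assume "\<not> norm (z $ Inr i) \<le> 1"
      moreover have eq: "norm (z $ Inr i) * norm (z $ Inl i) powr (1 - q) = 1" using z by (simp add: W_def)
      ultimately have "norm (z $ Inl i) powr (1 - q) \<le> 1"
        using mult_right_mono[of 1 "norm (z $ Inr i)" "norm (z $ Inl i) powr (1 - q)"] by simp
      then show "norm (z $ Inl i) \<le> 1" using q gr_one_powr[of "norm (z $ Inl i)" "1 - q"] by linarith
    qed
  qed
  have I: "I \<subseteq> polyfun" by (auto simp: I_def)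
  \<comment> \<open>Using the component \<open>X a\<close> as numerator of the weight ensures that
    the field does not vanish at the maximum.\<close>
  obtain k z where z: "z \<in> W" "X a z \<noteq> 0"
    and max: "\<And>z'. z' \<in> W \<Longrightarrow> weight k (X a) z' \<le> weight k (X a) z"
    by (rule weight_attains_max[OF I q X[of a] M, folded W_def, OF WM subsetD[OF KW p(1)] p(2)])
      (assumption, rule that, assumption+)
  have zl: "z $ Inl j \<noteq> 0" for j using z by (simp add: W_def)
  obtain \<delta> \<gamma> where \<delta>: "\<delta> > 0" and \<gamma>0: "\<gamma> 0 = z"
    and dr: "\<And>t j. t \<in> ball 0 \<delta> \<Longrightarrow>
       ((\<lambda>t. \<gamma> t $ Inr j) has_field_derivative of_real (q - 1) * (\<gamma> t $ Inr j * X j (\<gamma> t))) (at t)"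
    and df: "\<And>f t. f \<in> polyfun \<Longrightarrow> t \<in> ball 0 \<delta> \<Longrightarrow>
       ((\<lambda>t. f (\<gamma> t)) has_field_derivative (\<Sum>j\<in>UNIV. X j (\<gamma> t) * log_field q j f (\<gamma> t))) (at t)"
    and nz: "\<And>t j. t \<in> ball 0 \<delta> \<Longrightarrow> \<gamma> t $ Inl j \<noteq> 0"
    and modulus: "\<And>t j. t \<in> ball 0 \<delta> \<Longrightarrow>
       norm (\<gamma> t $ Inr j) * norm (\<gamma> t $ Inl j) powr (1 - q) = norm (z $ Inr j) * norm (z $ Inl j) powr (1 - q)"
    by (rule log_field_flow[of X z q, OF X zl]) (rule that, assumption+)
  have stay: "\<gamma> t \<in> W" if t: "t \<in> ball 0 \<delta>" for t
  proof -
    have "f (\<gamma> t) = 0" if f: "f \<in> I" for f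
    proof (rule invariant_set_vanishes_on_flow[OF df _ _ f t])
      show "g \<in> polyfun" if "g \<in> I" for g using that I by blast
      \<comment> \<open>By tangency the derivative of a member of \<open>I\<close> along the field
        is again a polynomial vanishing on \<open>K\<close>.\<close>
      show "(\<lambda>z. \<Sum>j\<in>UNIV. X j z * log_field q j g z) \<in> I" if "g \<in> I" for g
        using that tang I by (auto simp: I_def intro!: polyfun_sum polyfun.mult X polyfun_log_field)
      show "g (\<gamma> 0) = 0" if "g \<in> I" for g using that z by (simp add: \<gamma>0 W_def)
    qed
    then show ?thesis using nz[OF t] modulus[OF t] z(1) by (simp add: W_def)
  qed
  \<comment> \<open>From \<open>\<bar>u\<bar>\<^sup>2 = \<bar>v\<bar>\<^sup>2 + 2 Re (cnj v * (u - v)) + \<bar>u - v\<bar>\<^sup>2\<close>, the weight along the flow is the modulus of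
    the holomorphic function \<open>F\<close> times the exponential of a nonnegative defect.\<close>
  define F where "F t = X a (\<gamma> t) * (\<Prod>j\<in>UNIV. inverse (\<gamma> t $ Inl j) ^ k) *
      exp (2 * (\<Sum>j\<in>UNIV. cnj (z $ Inr j) * (\<gamma> t $ Inr j - z $ Inr j)))" for t
  define defect where "defect t = (\<Sum>j\<in>UNIV. (norm (\<gamma> t $ Inr j - z $ Inr j))\<^sup>2)" for t
  define c where "c = exp (\<Sum>j\<in>UNIV. (norm (z $ Inr j))\<^sup>2)"
  have weight_F: "weight k (X a) (\<gamma> t) = norm (F t) * exp (defect t) * c" for t
  proof -
    have "(norm u)\<^sup>2 = 2 * Re (cnj v * (u - v)) + (norm (u - v))\<^sup>2 + (norm v)\<^sup>2" for u v
      unfolding cmod_power2 by (simp add: power2_eq_square algebra_simps)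
    from sum.cong[OF refl this] have "(\<Sum>j\<in>UNIV. (norm (\<gamma> t $ Inr j))\<^sup>2) =
      (\<Sum>j\<in>UNIV. 2 * Re (cnj (z $ Inr j) * (\<gamma> t $ Inr j - z $ Inr j)) +
         (norm (\<gamma> t $ Inr j - z $ Inr j))\<^sup>2 + (norm (z $ Inr j))\<^sup>2)" .
    also have "\<dots> =
       Re (2 * (\<Sum>j\<in>UNIV. cnj (z $ Inr j) * (\<gamma> t $ Inr j - z $ Inr j))) + defect t + (\<Sum>j\<in>UNIV. (norm (z $ Inr j))\<^sup>2)"
      by (simp add: defect_def sum.distrib sum_distrib_left)
    finally have "(\<Sum>j\<in>UNIV. (norm (\<gamma> t $ Inr j))\<^sup>2) =
       Re (2 * (\<Sum>j\<in>UNIV. cnj (z $ Inr j) * (\<gamma> t $ Inr j - z $ Inr j))) + defect t + (\<Sum>j\<in>UNIV. (norm (z $ Inr j))\<^sup>2)" .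
    then show ?thesis
      by (simp only: weight_def F_def c_def norm_mult norm_power norm_inverse exp_add
          prod_norm[symmetric] norm_exp_eq_Re mult_ac)
  qed
  have "F holomorphic_on ball 0 \<delta>"
  proof -
    have "(\<lambda>t. f (\<gamma> t)) holomorphic_on ball 0 \<delta>" if "f \<in> polyfun" for f
      unfolding holomorphic_on_open[OF open_ball] using df[OF that] by blast
    note this[OF X] this[OF polyfun.coord]
    then show ?thesis
      unfolding F_def[abs_def] using nz by (intro holomorphic_intros) auto
  qed
  have F0: "F 0 \<noteq> 0" using zl z(2) by (simp add: F_def \<gamma>0)
  have c: "c > 0" by (simp add: c_def)
  have le: "norm (F t) * exp (defect t) \<le> norm (F 0)" if "t \<in> ball 0 \<delta>" for t
  proof -
    have "defect 0 = 0" by (simp add: defect_def \<gamma>0)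
    then show ?thesis
      using max[OF stay[OF that]] weight_F[of t] weight_F[of 0] c by (simp add: \<gamma>0)
  qed
  have defect0: "defect t \<ge> 0" for t by (simp add: defect_def sum_nonneg)
  \<comment> \<open>Since \<open>norm (F t) \<le> norm (F t) * exp (defect t) \<le> norm (F
    0)\<close>, the modulus of \<open>F\<close> has an interior maximum at 0.\<close>
  have "F constant_on ball 0 \<delta>"
  proof (rule maximum_modulus_principle[OF \<open>F holomorphic_on ball 0 \<delta>\<close> open_ball connected_ball open_ball subset_refl])
    show "0 \<in> ball 0 \<delta>" using \<delta> by simp
    show "norm (F t) \<le> norm (F 0)" if "t \<in> ball 0 \<delta>" for t
    proof -
      have "norm (F t) * 1 \<le> norm (F t) * exp (defect t)"
        using defect0 by (intro mult_left_mono) auto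
      then show ?thesis using le[OF that] by simp
    qed
  qed
  then have Fc: "F t = F 0" if "t \<in> ball 0 \<delta>" for t
    using that \<delta> unfolding constant_on_def by (metis centre_in_ball)
  \<comment> \<open>With \<open>F\<close> constant and nonzero, \<open>le\<close> leaves no room for
    a positive defect, so the \<open>u\<close> coordinates are frozen along the flow.\<close>
  have const: "\<gamma> t $ Inr a = z $ Inr a" if t: "t \<in> ball 0 \<delta>" for t
  proof -
    have "exp (defect t) \<le> 1" using le[OF t] F0 by (simp add: Fc[OF t])
    then have "defect t = 0" using defect0[of t] by simp
    then show ?thesis unfolding defect_def by (subst (asm) sum_nonneg_eq_0_iff) auto
  qed
  have "((\<lambda>t. \<gamma> t $ Inr a) has_field_derivative 0) (at 0)"
    by (rule has_field_derivative_transform_within_open[OF DERIV_const open_ball, of 0 0 \<delta>])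
      (use \<delta> const in auto)
  from DERIV_unique[OF this dr[of 0 a]] \<delta> have "z $ Inr a * X a z = 0"
    using q by (simp add: \<gamma>0)
  moreover have "z $ Inr a \<noteq> 0"
  proof
    assume "z $ Inr a = 0"
    moreover have "norm (z $ Inr a) * norm (z $ Inl a) powr (1 - q) = 1"
      using z(1) by (simp add: W_def)
    ultimately show False by simp
  qed
  ultimately show False using z(2) by simp
qed

section \<open>The scalar threshold operator\<close>

lemma lq_eta_pos:
  assumes "lam > 0" "mu > 0" "q < 1"
  shows "lq_eta lam mu q > 0"
  using assms by (simp add: lq_eta_def)

lemma lq_eta_powr:
  assumes "lam > 0" "mu > 0" "q < 1"
  shows "lq_eta lam mu q powr (2 - q) = 2 * lam * mu * (1 - q)"
  using assms by (simp add: lq_eta_def powr_powr)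

lemma lq_tau_eta: "lq_tau lam mu q = (2 - q) / (2 - 2 * q) * lq_eta lam mu q"
  by (simp add: lq_tau_def lq_eta_def)

text \<open>Measuring in units of \<open>lq_eta\<close> removes \<open>lam\<close> and
  \<open>mu\<close> from the penalty term, because \<open>lq_eta powr (2 - q)\<close> is
  proportional to \<open>lam * mu\<close>.\<close>

lemma penalty_eta:
  assumes "lam > 0" "mu > 0" "q < 1" "r > 0"
  shows "lam * mu * (r * lq_eta lam mu q) powr (q - 1) = lq_eta lam mu q * r powr (q - 1) / (2 * (1 - q))"
proof -
  define \<eta> where "\<eta> = lq_eta lam mu q"
  have \<eta>: "\<eta> > 0" using lq_eta_pos[OF assms(1-3)] by (simp add: \<eta>_def)
  have "lam * mu = \<eta> powr (2 - q) / (2 * (1 - q))"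
    using lq_eta_powr[OF assms(1-3)] assms(3) by (simp add: \<eta>_def field_simps)
  moreover have "\<eta> powr (2 - q) * \<eta> powr (q - 1) = \<eta>"
    using \<eta> by (simp flip: powr_add)
  ultimately show ?thesis
    using \<eta> assms(4) by (simp add: powr_mult flip: \<eta>_def)
qed

text \<open>In the unit \<open>r = v / lq_eta\<close> this is the tangent-line bound
  \<open>r powr (q - 1) \<ge> 1 + (q - 1) * (r - 1)\<close> at \<open>r = 1\<close>. So
  \<open>lq_tau\<close> is the minimal slope, and \<open>slope_eta\<close> shows that
  \<open>lq_eta\<close> attains it.\<close>

lemma tau_le_slope:
  assumes "lam > 0" "mu > 0" "q < 1" "v > 0"
  shows "lq_tau lam mu q \<le> v / 2 + lam * mu * v powr (q - 1)"
proof -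
  define \<eta> where "\<eta> = lq_eta lam mu q"
  have \<eta>: "\<eta> > 0" using lq_eta_pos[OF assms(1-3)] by (simp add: \<eta>_def)
  define r where "r = v / \<eta>"
  have r: "r > 0" "v = r * \<eta>" using \<eta> assms(4) by (auto simp: r_def)
  have "r powr (q - 1) \<ge> 1 + (q - 1) * ln r"
    using r(1) exp_ge_add_one_self[of "(q - 1) * ln r"] by (simp add: powr_def)
  moreover have "(q - 1) * ln r \<ge> (q - 1) * (r - 1)"
    using ln_le_minus_one[OF r(1)] assms(3) by (intro mult_left_mono_neg) auto
  ultimately have "2 - q \<le> (1 - q) * r + r powr (q - 1)" by (simp add: algebra_simps)
  then have "(2 - q) * (\<eta> / (2 * (1 - q))) \<le> ((1 - q) * r + r powr (q - 1)) * (\<eta> / (2 * (1 - q)))"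
    using \<eta> assms(3) by (intro mult_right_mono) auto
  moreover have "lq_tau lam mu q = (2 - q) * (\<eta> / (2 * (1 - q)))"
    by (simp add: lq_tau_eta \<eta>_def algebra_simps)
  moreover have "((1 - q) * r + r powr (q - 1)) * (\<eta> / (2 * (1 - q))) = v / 2 + \<eta> * r powr (q - 1) / (2 * (1 - q))"
    using assms(3) by (simp add: r(2) field_simps)
  ultimately show ?thesis
    using penalty_eta[OF assms(1-3) r(1)] by (simp add: r(2) \<eta>_def)
qed

lemma slope_eta:
  assumes "lam > 0" "mu > 0" "q < 1"
  shows "lq_eta lam mu q / 2 + lam * mu * lq_eta lam mu q powr (q - 1) = lq_tau lam mu q"
proof -
  have "lam * mu * lq_eta lam mu q powr (q - 1) = lq_eta lam mu q / (2 * (1 - q))"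
    using penalty_eta[OF assms, of 1] by simp
  moreover have "t / 2 + t / (2 * (1 - q)) = (2 - q) / (2 - 2 * q) * t" for t
    using assms(3) by (simp add: field_simps)
  ultimately show ?thesis by (simp only: lq_tau_eta)
qed

definition prox_energy :: "real \<Rightarrow> real \<Rightarrow> real \<Rightarrow> real \<Rightarrow> real" where
  "prox_energy c q z v = \<bar>z - v\<bar>\<^sup>2 / 2 + c * \<bar>v\<bar> powr q"

text \<open>Factoring out \<open>\<bar>v\<bar>\<close> reduces the comparison of \<open>v\<close>
  with 0 to that of \<open>\<bar>z\<bar>\<close> with the slope.\<close>

lemma prox_energy_diff:
  "v \<noteq> 0 \<Longrightarrow> prox_energy c q z v - prox_energy c q z 0 =
     \<bar>v\<bar> * (\<bar>v\<bar> / 2 + c * \<bar>v\<bar> powr (q - 1)) - z * v"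
proof -
  assume "v \<noteq> 0"
  then have "\<bar>v\<bar> * \<bar>v\<bar> powr (q - 1) = \<bar>v\<bar> powr q"
    by (simp add: powr_mult_base)
  moreover have "\<bar>v\<bar> * \<bar>v\<bar> = v * v" by simp
  ultimately show ?thesis
    by (simp add: prox_energy_def power2_eq_square field_simps)
qed

lemma prox_energy_attains_min:
  assumes "c > 0" "q > 0"
  shows "\<exists>v. \<forall>w. prox_energy c q z v \<le> prox_energy c q z w"
proof -
  have "continuous_on (cball 0 (2 * \<bar>z\<bar>)) (prox_energy c q z)"
    unfolding prox_energy_def[abs_def] using assms
    by (intro continuous_intros continuous_on_powr') auto
  then have "\<exists>v\<in>cball 0 (2 * \<bar>z\<bar>). \<forall>w\<in>cball 0 (2 * \<bar>z\<bar>). prox_energy c q z v \<le> prox_energy c q z w"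
    by (intro continuous_attains_inf) auto
  then obtain v where "\<forall>w\<in>cball 0 (2 * \<bar>z\<bar>). prox_energy c q z v \<le> prox_energy c q z w"
    by blast
  then have v: "prox_energy c q z v \<le> prox_energy c q z w" if "\<bar>w\<bar> \<le> 2 * \<bar>z\<bar>" for w
    using that by (simp add: dist_norm)
  \<comment> \<open>Such a \<open>w\<close> is farther from \<open>z\<close> than 0 is, and its
    penalty is nonnegative, so 0 does at least as well.\<close>
  have "prox_energy c q z v \<le> prox_energy c q z w" if "\<bar>w\<bar> > 2 * \<bar>z\<bar>" for w
  proof -
    have "\<bar>z\<bar>\<^sup>2 \<le> \<bar>z - w\<bar>\<^sup>2" using that by (intro power_mono) auto
    moreover have "c * \<bar>w\<bar> powr q \<ge> 0" using assms by simp
    ultimately have "prox_energy c q z 0 \<le> prox_energy c q z w"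
      by (simp add: prox_energy_def)
    with v[of 0] show ?thesis by simp
  qed
  with v show ?thesis by (meson not_le)
qed

lemma prox_energy_diff_eta:
  assumes "lam > 0" "mu > 0" "q < 1" "z \<noteq> 0"
  shows "prox_energy (lam * mu) q z (sgn z * lq_eta lam mu q) - prox_energy (lam * mu) q z 0 =
    lq_eta lam mu q * (lq_tau lam mu q - \<bar>z\<bar>)"
proof -
  define v where "v = sgn z * lq_eta lam mu q"
  have \<eta>: "lq_eta lam mu q > 0" using lq_eta_pos[OF assms(1-3)] .
  have v: "\<bar>v\<bar> = lq_eta lam mu q" "v \<noteq> 0"
    using \<eta> assms(4) by (simp_all add: v_def abs_mult sgn_if)
  have "z * v = \<bar>z\<bar> * lq_eta lam mu q"
    by (simp add: v_def abs_sgn mult.assoc)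
  then show ?thesis
    using prox_energy_diff[OF v(2), of "lam * mu" q z] slope_eta[OF assms(1-3)] v(1)
    by (simp add: right_diff_distrib mult.commute flip: v_def)
qed

text \<open>The slope never falls below \<open>lq_tau\<close>, which makes 0 optimal up to that
  threshold; beyond it \<open>sgn z * lq_eta\<close> has smaller energy than 0.\<close>

lemma prox_energy_zero_min_iff_tau:
  assumes "lam > 0" "mu > 0" "q < 1"
  shows "(\<forall>w. prox_energy (lam * mu) q z 0 \<le> prox_energy (lam * mu) q z w) \<longleftrightarrow> \<bar>z\<bar> \<le> lq_tau lam mu q"
proof
  assume "\<bar>z\<bar> \<le> lq_tau lam mu q"
  have "prox_energy (lam * mu) q z 0 \<le> prox_energy (lam * mu) q z w" if "w \<noteq> 0" for w
  proof -
    have "z * w \<le> \<bar>z\<bar> * \<bar>w\<bar>" by (metis abs_ge_self abs_mult)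
    also have "\<dots> \<le> (\<bar>w\<bar> / 2 + lam * mu * \<bar>w\<bar> powr (q - 1)) * \<bar>w\<bar>"
      using tau_le_slope[OF assms, of "\<bar>w\<bar>"] that \<open>\<bar>z\<bar> \<le> lq_tau lam mu q\<close> by (intro mult_right_mono) auto
    finally show ?thesis using prox_energy_diff[OF that, of "lam * mu" q z] by (simp add: mult.commute)
  qed
  then show "\<forall>w. prox_energy (lam * mu) q z 0 \<le> prox_energy (lam * mu) q z w" by (metis order_refl)
next
  assume min: "\<forall>w. prox_energy (lam * mu) q z 0 \<le> prox_energy (lam * mu) q z w"
  define \<eta> where "\<eta> = lq_eta lam mu q"
  have \<eta>: "\<eta> > 0" using lq_eta_pos[OF assms] by (simp add: \<eta>_def)
  show "\<bar>z\<bar> \<le> lq_tau lam mu q"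
  proof (cases "z = 0")
    case True
    then show ?thesis using \<eta> assms(3) by (simp add: lq_tau_eta \<eta>_def)
  next
    case False
    have "0 \<le> \<eta> * (lq_tau lam mu q - \<bar>z\<bar>)"
      using min[rule_format, of "sgn z * \<eta>"] prox_energy_diff_eta[OF assms False]
      unfolding \<eta>_def by linarith
    then show ?thesis using \<eta> by (simp add: zero_le_mult_iff)
  qed
qed

lemma prox_energy_eta_min:
  assumes "lam > 0" "mu > 0" "q < 1" "\<bar>z\<bar> = lq_tau lam mu q"
  shows "prox_energy (lam * mu) q z (sgn z * lq_eta lam mu q) \<le> prox_energy (lam * mu) q z w"
proof -
  define \<eta> where "\<eta> = lq_eta lam mu q"
  have \<eta>: "\<eta> > 0" using lq_eta_pos[OF assms(1-3)] by (simp add: \<eta>_def)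
  have "lq_tau lam mu q > 0" using \<eta> assms(3) by (simp add: lq_tau_eta flip: \<eta>_def)
  then have "z \<noteq> 0" using assms(4) by auto
  then have "prox_energy (lam * mu) q z (sgn z * \<eta>) = prox_energy (lam * mu) q z 0"
    using prox_energy_diff_eta[of lam mu q z] assms by (simp add: \<eta>_def)
  then show ?thesis
    using prox_energy_zero_min_iff_tau[OF assms(1-3), of z] assms(4) by (simp add: \<eta>_def)
qed

text \<open>At \<open>\<bar>z\<bar> = lq_tau\<close> the candidates 0 and
  \<open>sgn z * lq_eta\<close> are both minimizers; elsewhere the choice operator in
  \<open>lq_prox\<close> returns a minimizer because one exists.\<close>

lemma lq_threshold_min:
  assumes "lam > 0" "mu > 0" "0 < q" "q < 1"
  shows "prox_energy (lam * mu) q z (lq_threshold lam mu q z t) \<le> prox_energy (lam * mu) q z w"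
proof (cases "\<bar>z\<bar> = lq_tau lam mu q")
  case True
  then show ?thesis
    using prox_energy_eta_min[OF assms(1,2,4) True] prox_energy_zero_min_iff_tau[OF assms(1,2,4), of z]
    by (simp add: lq_threshold_def)
next
  case False
  obtain v where "\<forall>w. prox_energy (lam * mu) q z v \<le> prox_energy (lam * mu) q z w"
    using prox_energy_attains_min[of "lam * mu" q z] assms by auto
  then have "is_arg_min (prox_energy (lam * mu) q z) (\<lambda>_. True) v"
    by (simp add: is_arg_min_linorder)
  then have "is_arg_min (prox_energy (lam * mu) q z) (\<lambda>_. True) (lq_prox lam mu q z)"
    unfolding lq_prox_def arg_min_def prox_energy_def[symmetric] by (rule someI)
  then show ?thesis using False by (simp add: lq_threshold_def is_arg_min_linorder)
qed

text \<open>Within distance \<open>\<bar>v\<bar>\<close> of \<open>v\<close> the absolute value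
  agrees with the linear function \<open>sgn v * w\<close>, which makes the energy differentiable at
  \<open>v\<close>.\<close>

lemma nonzero_prox_stationary:
  assumes min: "\<And>w. prox_energy c q z v \<le> prox_energy c q z w" and "v \<noteq> 0"
  shows "v - z + c * q * sgn v * \<bar>v\<bar> powr (q - 1) = 0"
proof (rule DERIV_local_min)
  define f where "f w = (z - w)\<^sup>2 / 2 + c * (sgn v * w) powr q" for w
  have "sgn v * v > 0" using assms(2) by (simp add: abs_sgn[symmetric] mult.commute)
  then have "(f has_real_derivative v - z + c * (q * (sgn v * v) powr (q - 1) * sgn v)) (at v)"
    unfolding f_def[abs_def]
    by (auto intro!: derivative_eq_intros simp: powr_diff field_simps)
  moreover have "sgn v * v = \<bar>v\<bar>" by (simp add: abs_sgn mult.commute)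
  ultimately show "(f has_real_derivative v - z + c * q * sgn v * \<bar>v\<bar> powr (q - 1)) (at v)"
    by (simp add: mult_ac)
  show "\<bar>v\<bar> > 0" using assms(2) by simp
  show "\<forall>w. \<bar>v - w\<bar> < \<bar>v\<bar> \<longrightarrow> f v \<le> f w"
  proof (intro allI impI)
    fix w assume "\<bar>v - w\<bar> < \<bar>v\<bar>"
    then have "sgn v * w = \<bar>w\<bar>" by (auto simp: sgn_if split: if_splits)
    moreover have "sgn v * v = \<bar>v\<bar>" by (simp add: abs_sgn mult.commute)
    ultimately show "f v \<le> f w"
      using min[of w] by (simp add: f_def prox_energy_def)
  qed
qed

text \<open>Eliminating \<open>z\<close> between the stationarity equation and the comparison with 0
  leaves \<open>2 * c * (1 - q) * \<bar>v\<bar> powr q \<le> v * v\<close>, that is,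
  \<open>lq_eta powr (2 - q) \<le> \<bar>v\<bar> powr (2 - q)\<close>.\<close>

lemma nonzero_prox_ge_eta:
  assumes "lam > 0" "mu > 0" "q < 1"
    and min: "\<And>w. prox_energy (lam * mu) q z v \<le> prox_energy (lam * mu) q z w" and "v \<noteq> 0"
  shows "lq_eta lam mu q \<le> \<bar>v\<bar>"
proof -
  define c where "c = lam * mu"
  have v: "\<bar>v\<bar> * \<bar>v\<bar> powr (q - 1) = \<bar>v\<bar> powr q"
    using assms(5) by (simp add: powr_mult_base)
  have "z = v + c * q * sgn v * \<bar>v\<bar> powr (q - 1)"
    using nonzero_prox_stationary[OF min assms(5)] by (simp add: c_def)
  then have "z * v = v * v + c * q * (sgn v * v) * \<bar>v\<bar> powr (q - 1)"
    by (simp add: algebra_simps)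
  also have "sgn v * v = \<bar>v\<bar>" by (simp add: abs_sgn mult.commute)
  finally have zv: "z * v = v * v + c * q * \<bar>v\<bar> powr q"
    using v by (simp add: mult.assoc)
  have "\<bar>v\<bar> * (\<bar>v\<bar> / 2 + c * \<bar>v\<bar> powr (q - 1)) - z * v \<le> 0"
    using min[of 0] prox_energy_diff[OF assms(5), of c q z] by (simp add: c_def)
  moreover have "\<bar>v\<bar> * (\<bar>v\<bar> / 2 + c * \<bar>v\<bar> powr (q - 1)) = v * v / 2 + c * \<bar>v\<bar> powr q"
    unfolding v[symmetric] by (simp add: algebra_simps)
  ultimately have "v * v / 2 + c * \<bar>v\<bar> powr q - (v * v + c * q * \<bar>v\<bar> powr q) \<le> 0"
    unfolding zv by linarith
  then have "2 * c * (1 - q) * \<bar>v\<bar> powr q \<le> v * v"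
    by (simp add: algebra_simps)
  also have "v * v = \<bar>v\<bar> powr (2 - q) * \<bar>v\<bar> powr q"
    using assms(5) by (simp add: power2_eq_square flip: powr_add)
  finally have "lq_eta lam mu q powr (2 - q) \<le> \<bar>v\<bar> powr (2 - q)"
    using assms(5) lq_eta_powr[OF assms(1-3)] by (simp add: c_def mult.assoc)
  then show ?thesis
    using powr_less_mono2[of "2 - q" "\<bar>v\<bar>" "lq_eta lam mu q"] assms(3) by linarith
qed

section \<open>Sequences with vanishing steps\<close>

lemma dist_within_window:
  fixes x :: "nat \<Rightarrow> 'a::real_normed_vector"
  assumes "n \<le> m" "m \<le> n + N"
  shows "norm (x m - x n) \<le> (\<Sum>j<N. norm (x (Suc (n + j)) - x (n + j)))"
proof -
  obtain d where d: "m = n + d" "d \<le> N" using assms le_Suc_ex by force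
  have "norm (x (n + d) - x n) \<le> (\<Sum>j<d. norm (x (Suc (n + j)) - x (n + j)))" for d
  proof (induction d)
    case (Suc d)
    have "norm (x (n + Suc d) - x n) \<le> norm (x (Suc (n + d)) - x (n + d)) + norm (x (n + d) - x n)"
      using norm_triangle_ineq[of "x (Suc (n + d)) - x (n + d)" "x (n + d) - x n"] by simp
    with Suc show ?case by simp
  qed simp
  also have "(\<Sum>j<d. norm (x (Suc (n + j)) - x (n + j))) \<le> (\<Sum>j<N. norm (x (Suc (n + j)) - x (n + j)))"
    using d by (intro sum_mono2) auto
  finally show ?thesis by (simp add: d)
qed

lemma connected_polygonal_tail:
  fixes x :: "nat \<Rightarrow> 'a::real_normed_vector"
  shows "connected (\<Union>k\<in>{n..}. closed_segment (x k) (x (Suc k)))"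
proof -
  define V where "V j = (\<Union>k\<in>{n..n + j}. closed_segment (x k) (x (Suc k)))" for j
  have V: "connected (V j)" for j
  proof (induction j)
    case (Suc j)
    have "V (Suc j) = V j \<union> closed_segment (x (n + Suc j)) (x (Suc (n + Suc j)))"
      by (auto simp: V_def atLeastAtMostSuc_conv)
    moreover have "x (n + Suc j) \<in> V j \<inter> closed_segment (x (n + Suc j)) (x (Suc (n + Suc j)))"
      by (auto simp: V_def intro!: bexI[of _ "n + j"])
    ultimately show ?case using connected_Un[OF Suc connected_segment(1)] by auto
  qed (simp add: V_def)
  have "(\<Union>k\<in>{n..}. closed_segment (x k) (x (Suc k))) = (\<Union>j. V j)"
  proof
    show "(\<Union>k\<in>{n..}. closed_segment (x k) (x (Suc k))) \<subseteq> (\<Union>j. V j)"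
    proof
      fix u assume "u \<in> (\<Union>k\<in>{n..}. closed_segment (x k) (x (Suc k)))"
      then obtain k where "k \<ge> n" "u \<in> closed_segment (x k) (x (Suc k))" by auto
      then show "u \<in> (\<Union>j. V j)" by (auto simp: V_def intro!: exI[of _ "k - n"] bexI[of _ k])
    qed
  qed (auto simp: V_def)
  moreover have "x n \<in> (\<Inter>j. V j)" by (auto simp: V_def intro!: bexI[of _ n])
  ultimately show ?thesis using connected_Union[of "range V"] V by auto
qed

text \<open>Joining the iterates by segments makes each tail connected. The closures of the tails
  are nested and compact, so their intersection is connected, and vanishing steps make all its
  points cluster points of the sequence.\<close>

theorem convergent_of_scattered_cluster_points:
  fixes x :: "nat \<Rightarrow> 'a::euclidean_space"
  assumes bdd: "bounded (range x)" and steps: "(\<lambda>n. x (Suc n) - x n) \<longlonglongrightarrow> 0"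
    and cluster: "\<And>p r. filterlim r at_top sequentially \<Longrightarrow> (\<lambda>n. x (r n)) \<longlonglongrightarrow> p \<Longrightarrow> p \<in> S"
    and scattered: "\<And>C p p'. C \<subseteq> S \<Longrightarrow> connected C \<Longrightarrow> p \<in> C \<Longrightarrow> p' \<in> C \<Longrightarrow> p = p'"
  shows "\<exists>p\<in>S. x \<longlonglongrightarrow> p"
proof -
  define U where "U n = (\<Union>k\<in>{n..}. closed_segment (x k) (x (Suc k)))" for n
  define C where "C n = closure (U n)" for n
  define K where "K = \<Inter> (range C)"
  have xU: "x k \<in> C n" if "k \<ge> n" for k n
    using that closure_subset[of "U n"] by (force simp: C_def U_def)
  have conn: "connected (C n)" for n
    unfolding C_def U_def by (intro connected_imp_connected_closure connected_polygonal_tail)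
  have comp: "compact (C n)" for n
  proof -
    have "U n \<subseteq> convex hull (range x)"
      unfolding U_def by (intro UN_least closed_segment_subset) (auto intro: hull_inc)
    then show ?thesis
      unfolding C_def compact_closure
      using bounded_subset bounded_convex_hull[OF bdd] by blast
  qed
  have nest: "C n \<subseteq> C m" if "m \<le> n" for m n
    unfolding C_def U_def using that by (intro closure_mono) force
  have KS: "K \<subseteq> S"
  proof
    fix p assume p: "p \<in> K"
    \<comment> \<open>A point of a segment lies within one step length of the first endpoint, so
      points of \<open>K\<close> are approached by the iterates themselves.\<close>
    have "\<exists>k\<ge>n. dist (x k) p < 1 / Suc n + norm (x (Suc k) - x k)" for n
    proof -
      have "p \<in> closure (U n)" using p by (auto simp: K_def C_def)
      then obtain u where "u \<in> U n" and u: "dist u p < 1 / Suc n"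
        unfolding closure_approachable by (metis of_nat_0_less_iff zero_less_Suc zero_less_divide_1_iff)
      then obtain k where k: "k \<ge> n" "u \<in> closed_segment (x k) (x (Suc k))" by (auto simp: U_def)
      have "dist (x k) u \<le> norm (x (Suc k) - x k)"
        using segment_bound1[OF k(2)] by (simp add: dist_norm norm_minus_commute)
      then show ?thesis using k(1) u dist_triangle[of "x k" p u] by (intro exI[of _ k]) auto
    qed
    then obtain r where r: "\<And>n. r n \<ge> n" "\<And>n. dist (x (r n)) p < 1 / Suc n + norm (x (Suc (r n)) - x (r n))"
      by metis
    have rlim: "filterlim r at_top sequentially"
      using r(1) by (intro filterlim_at_top_mono[OF filterlim_ident]) auto
    have "(\<lambda>n. 1 / real (Suc n) + norm (x (Suc (r n)) - x (r n))) \<longlonglongrightarrow> 0 + 0"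
      using filterlim_compose[OF tendsto_norm_zero[OF steps] rlim]
      by (intro tendsto_add LIMSEQ_Suc[OF lim_1_over_n]) auto
    then have "(\<lambda>n. 1 / real (Suc n) + norm (x (Suc (r n)) - x (r n))) \<longlonglongrightarrow> 0" by simp
    from Lim_null_comparison[OF _ this, of "\<lambda>n. dist (x (r n)) p"] less_imp_le[OF r(2)]
    have "(\<lambda>n. dist (x (r n)) p) \<longlonglongrightarrow> 0" by simp
    then have "(\<lambda>n. x (r n)) \<longlonglongrightarrow> p" by (subst tendsto_dist_iff)
    from cluster[OF rlim this] show "p \<in> S" .
  qed
  have "connected K" unfolding K_def by (intro connected_nest comp conn nest)
  have "K \<noteq> {}" unfolding K_def
  proof (rule compact_nest)
    show "compact (C n)" "C n \<noteq> {}" for n using comp xU[of n n] by auto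
  qed (use nest in auto)
  then obtain p where p: "p \<in> K" by blast
  have K: "K = {p}" using scattered[OF KS \<open>connected K\<close> p] p by blast
  have "x \<longlonglongrightarrow> p"
  proof (rule LIMSEQ_I)
    fix e :: real assume e: "e > 0"
    \<comment> \<open>If no tail stayed in the ball, compactness would give a point of
      \<open>K\<close> outside it, contradicting \<open>K = {p}\<close>.\<close>
    have "\<exists>n. C n - ball p e = {}"
    proof (rule ccontr)
      assume ne: "\<nexists>n. C n - ball p e = {}"
      have "\<Inter> (range (\<lambda>n. C n - ball p e)) \<noteq> {}"
      proof (rule compact_nest)
        show "compact (C n - ball p e)" "C n - ball p e \<noteq> {}" for n
          using ne comp by (auto intro: compact_diff)
      qed (use nest in blast)
      then obtain u where "\<And>n. u \<in> C n - ball p e" by blast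
      then have "u \<in> K" "u \<notin> ball p e" by (auto simp: K_def)
      then show False using K e by simp
    qed
    then obtain n where "C n \<subseteq> ball p e" by blast
    then show "\<exists>n. \<forall>k\<ge>n. norm (x k - p) < e"
      using xU by (intro exI[of _ n]) (force simp: dist_norm norm_minus_commute)
  qed
  with p KS show ?thesis by blast
qed

section \<open>Cyclic coordinate descent\<close>

text \<open>This trades the cyclic numbering for an update index per step that takes each value in
  every window of \<open>CARD('n)\<close> steps.\<close>

lemma CCD_sequence_index:
  fixes e :: "nat \<Rightarrow> 'n::finite"
  assumes ccd: "CCD_sequence e A y lam q mu x" and e: "bij_betw e {1..CARD('n)} UNIV"
  obtains idx where
    "\<And>n. x (Suc n) $ idx n = lq_threshold lam mu q
       (x n $ idx n - mu * (column (idx n) A \<bullet> (A *v x n - y))) (x n $ idx n)"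
    "\<And>n j. j \<noteq> idx n \<Longrightarrow> x (Suc n) $ j = x n $ j"
    "\<And>n i. \<exists>m\<ge>n. m < n + CARD('n) \<and> idx m = i"
proof -
  define N where "N = CARD('n)"
  have N: "N > 0" by (simp add: N_def)
  have "\<forall>n. \<exists>k. k \<in> {1..N} \<and> k mod N = (n + 1) mod N \<and>
      x (Suc n) $ e k = lq_threshold lam mu q
       (x n $ e k - mu * (column (e k) A \<bullet> (A *v x n - y))) (x n $ e k) \<and>
      (\<forall>j. j \<noteq> e k \<longrightarrow> x (Suc n) $ j = x n $ j)"
    using ccd unfolding CCD_sequence_def N_def Let_def Bex_def by simp
  then obtain k where k: "\<And>n. k n \<in> {1..N}" "\<And>n. k n mod N = (n + 1) mod N"
    "\<And>n. x (Suc n) $ e (k n) = lq_threshold lam mu q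
       (x n $ e (k n) - mu * (column (e (k n)) A \<bullet> (A *v x n - y))) (x n $ e (k n))"
    "\<And>n j. j \<noteq> e (k n) \<Longrightarrow> x (Suc n) $ j = x n $ j"
    by metis
  have "\<exists>m\<ge>n. m < n + N \<and> e (k m) = i" for n i
  proof -
    obtain k0 where k0: "k0 \<in> {1..N}" "e k0 = i"
      using e unfolding N_def bij_betw_def by (metis UNIV_I imageE)
    \<comment> \<open>The offset is \<open>k0 - (n + 1)\<close> modulo \<open>N\<close>; the summand
      \<open>N * (n + 1)\<close> prevents truncated subtraction.\<close>
    define m where "m = n + ((k0 + N * (n + 1) - (n + 1)) mod N)"
    have le: "n + 1 \<le> N * (n + 1)" using N mult_le_mono1[of 1 N "n + 1"] by simp
    have "(m + 1) mod N = (n + 1 + (k0 + N * (n + 1) - (n + 1)) mod N) mod N" by (simp add: m_def)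
    also have "\<dots> = (n + 1 + (k0 + N * (n + 1) - (n + 1))) mod N" by (rule mod_add_right_eq)
    also have "n + 1 + (k0 + N * (n + 1) - (n + 1)) = k0 + N * (n + 1)" using le by linarith
    also have "\<dots> mod N = k0 mod N" by (rule mod_mult_self2)
    finally have "k m mod N = k0 mod N" using k(2)[of m] by simp
    moreover have "k m \<in> {1..N}" by (rule k(1))
    \<comment> \<open>Numbers in \<open>{1..N}\<close> are determined by their residues, with
      \<open>N\<close> representing 0.\<close>
    ultimately have "k m = k0"
      using k0(1) by (cases "k m = N"; cases "k0 = N") auto
    moreover have "m < n + N" "m \<ge> n" using N by (simp_all add: m_def)
    ultimately show ?thesis using k0(2) by blast
  qed
  then show ?thesis using that[of "\<lambda>n. e (k n)"] k(3,4) unfolding N_def by blast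
qed

lemma lq_objective_coordinate_change:
  fixes A :: "real ^ 'n ^ 'm" and x x' :: "real ^ 'n"
  assumes same: "\<And>j. j \<noteq> i \<Longrightarrow> x' $ j = x $ j"
  shows "lq_objective A y lam q x' - lq_objective A y lam q x =
    (x' $ i - x $ i) * (column i A \<bullet> (A *v x - y)) + (x' $ i - x $ i)\<^sup>2 * (norm (column i A))\<^sup>2 / 2 +
    lam * (\<bar>x' $ i\<bar> powr q - \<bar>x $ i\<bar> powr q)"
proof -
  define d where "d = x' $ i - x $ i"
  have "x' = x + d *\<^sub>R axis i 1" using same by (auto simp: vec_eq_iff axis_def d_def)
  then have "A *v x' - y = (A *v x - y) + d *\<^sub>R column i A"
    by (simp add: matrix_vector_right_distrib matrix_vector_mult_basis algebra_simps
        linear_scale[OF matrix_vector_mul_linear])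
  then have "(norm (A *v x' - y))\<^sup>2 =
      (norm (A *v x - y))\<^sup>2 + 2 * d * (column i A \<bullet> (A *v x - y)) + d\<^sup>2 * (norm (column i A))\<^sup>2"
    by (simp add: power2_norm_eq_inner inner_add_left inner_add_right inner_commute
        power2_eq_square[of d] algebra_simps)
  moreover have "(\<Sum>j\<in>UNIV. \<bar>x' $ j\<bar> powr q) - (\<Sum>j\<in>UNIV. \<bar>x $ j\<bar> powr q) = \<bar>x' $ i\<bar> powr q - \<bar>x $ i\<bar> powr q"
  proof -
    have "(\<Sum>j\<in>UNIV - {i}. \<bar>x' $ j\<bar> powr q) = (\<Sum>j\<in>UNIV - {i}. \<bar>x $ j\<bar> powr q)"
      using same by (intro sum.cong) auto
    then show ?thesis
      using sum.remove[of UNIV i "\<lambda>j. \<bar>x' $ j\<bar> powr q"] sum.remove[of UNIV i "\<lambda>j. \<bar>x $ j\<bar> powr q"] by simp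
  qed
  then have "lam * (\<Sum>j\<in>UNIV. \<bar>x' $ j\<bar> powr q) - lam * (\<Sum>j\<in>UNIV. \<bar>x $ j\<bar> powr q) =
      lam * (\<bar>x' $ i\<bar> powr q - \<bar>x $ i\<bar> powr q)"
    by (simp flip: right_diff_distrib)
  ultimately show ?thesis
    unfolding lq_objective_def d_def[symmetric] by (simp add: field_simps)
qed

text \<open>Comparing the minimizer with the old value \<open>x $ i\<close> bounds the linear and
  penalty terms by \<open>- d\<^sup>2 / (2 * mu)\<close>; the exact expansion of the objective adds
  back at most \<open>d\<^sup>2 * Lmax A / 2\<close>.\<close>

lemma CCD_step_decrease:
  fixes A :: "real ^ 'n ^ 'm" and x x' :: "real ^ 'n"
  assumes "lam > 0" "mu > 0" "0 < q" "q < 1"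
    and step: "x' $ i = lq_threshold lam mu q (x $ i - mu * (column i A \<bullet> (A *v x - y))) (x $ i)"
    and same: "\<And>j. j \<noteq> i \<Longrightarrow> x' $ j = x $ j"
  shows "(1 / mu - Lmax A) / 2 * (norm (x' - x))\<^sup>2 \<le> lq_objective A y lam q x - lq_objective A y lam q x'"
proof -
  define d where "d = x' $ i - x $ i"
  define \<rho> where "\<rho> = column i A \<bullet> (A *v x - y)"
  define D where "D = \<bar>x' $ i\<bar> powr q - \<bar>x $ i\<bar> powr q"
  have "x' - x = d *\<^sub>R axis i 1" using same by (auto simp: vec_eq_iff axis_def d_def)
  then have nd: "(norm (x' - x))\<^sup>2 = d\<^sup>2" by simp
  have "prox_energy (lam * mu) q (x $ i - mu * \<rho>) (x' $ i) \<le> prox_energy (lam * mu) q (x $ i - mu * \<rho>) (x $ i)"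
    unfolding step \<rho>_def by (rule lq_threshold_min[OF assms(1-4)])
  moreover have "x $ i - mu * \<rho> - x' $ i = - (d + mu * \<rho>)" "x $ i - mu * \<rho> - x $ i = - (mu * \<rho>)"
    by (simp_all add: d_def)
  ultimately have "(d + mu * \<rho>)\<^sup>2 / 2 + lam * mu * \<bar>x' $ i\<bar> powr q \<le> (mu * \<rho>)\<^sup>2 / 2 + lam * mu * \<bar>x $ i\<bar> powr q"
    by (simp only: prox_energy_def power2_abs power2_minus)
  then have "(d + mu * \<rho>)\<^sup>2 / 2 + lam * mu * D \<le> (mu * \<rho>)\<^sup>2 / 2"
    by (simp add: D_def right_diff_distrib)
  moreover have "mu * (d\<^sup>2 / (2 * mu) + \<rho> * d + lam * D) =
      (d + mu * \<rho>)\<^sup>2 / 2 - (mu * \<rho>)\<^sup>2 / 2 + lam * mu * D"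
    using assms(2) by (simp add: power2_eq_square field_simps)
  ultimately have "mu * (d\<^sup>2 / (2 * mu) + \<rho> * d + lam * D) \<le> mu * 0"
    by linarith
  then have "d\<^sup>2 / (2 * mu) + \<rho> * d + lam * D \<le> 0"
    using assms(2) by (simp only: mult_le_cancel_left_pos)
  moreover have "(norm (column i A))\<^sup>2 \<le> Lmax A" unfolding Lmax_def by (rule Max_ge) auto
  then have "d\<^sup>2 * (norm (column i A))\<^sup>2 \<le> d\<^sup>2 * Lmax A" by (rule mult_left_mono) auto
  moreover have "lq_objective A y lam q x' - lq_objective A y lam q x =
      d * \<rho> + d\<^sup>2 * (norm (column i A))\<^sup>2 / 2 + lam * D"
    unfolding d_def \<rho>_def D_def by (rule lq_objective_coordinate_change[OF same])
  ultimately show ?thesis unfolding nd by (simp add: field_simps)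
qed

lemma lq_objective_sublevel_bounded:
  assumes "lam > 0" "0 < q"
  shows "bounded {x :: real ^ 'n. lq_objective A y lam q x \<le> c}"
proof (rule boundedI)
  fix x :: "real ^ 'n" assume x: "x \<in> {x. lq_objective A y lam q x \<le> c}"
  have "\<bar>x $ i\<bar> \<le> (c / lam) powr (1 / q)" for i
  proof -
    have "\<bar>x $ i\<bar> powr q \<le> (\<Sum>i\<in>UNIV. \<bar>x $ i\<bar> powr q)" by (rule member_le_sum) auto
    then have "lam * \<bar>x $ i\<bar> powr q \<le> lam * (\<Sum>i\<in>UNIV. \<bar>x $ i\<bar> powr q)"
      using assms by (intro mult_left_mono) auto
    also have "\<dots> \<le> c" using x zero_le_power2[of "norm (A *v x - y)"] unfolding lq_objective_def mem_Collect_eq by linarith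
    finally have "\<bar>x $ i\<bar> powr q \<le> c / lam" using assms by (simp add: pos_le_divide_eq mult.commute)
    then have "(\<bar>x $ i\<bar> powr q) powr (1 / q) \<le> (c / lam) powr (1 / q)"
      using assms by (intro powr_mono2) auto
    then show ?thesis using assms by (simp add: powr_powr)
  qed
  then have "(\<Sum>i\<in>UNIV. \<bar>x $ i\<bar>) \<le> CARD('n) * (c / lam) powr (1 / q)"
    using sum_bounded_above[of UNIV "\<lambda>i. \<bar>x $ i\<bar>"] by simp
  then show "norm x \<le> CARD('n) * (c / lam) powr (1 / q)"
    using norm_le_l1_cart[of x] by linarith
qed

text \<open>The decreasing objective is bounded below, so its successive differences tend to 0, and
  they dominate the squared steps up to the factor \<open>\<kappa>\<close>. Boundedness comes from
  the sublevel set of the starting point.\<close>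

lemma CCD_bounded_vanishing_steps:
  fixes A :: "real ^ 'n ^ 'm" and x :: "nat \<Rightarrow> real ^ 'n"
  assumes "lam > 0" "mu > 0" "0 < q" "q < 1" and L: "Lmax A < 1 / mu"
    and step: "\<And>n. x (Suc n) $ idx n = lq_threshold lam mu q
       (x n $ idx n - mu * (column (idx n) A \<bullet> (A *v x n - y))) (x n $ idx n)"
    and same: "\<And>n j. j \<noteq> idx n \<Longrightarrow> x (Suc n) $ j = x n $ j"
  shows "bounded (range x)" "(\<lambda>n. x (Suc n) - x n) \<longlonglongrightarrow> 0"
proof -
  define T where "T n = lq_objective A y lam q (x n)" for n
  define \<kappa> where "\<kappa> = (1 / mu - Lmax A) / 2"
  have \<kappa>: "\<kappa> > 0" using L by (simp add: \<kappa>_def)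
  have dec: "\<kappa> * (norm (x (Suc n) - x n))\<^sup>2 \<le> T n - T (Suc n)" for n
    unfolding T_def \<kappa>_def using CCD_step_decrease[OF assms(1-4) step same] .
  have "T (Suc n) \<le> T n" for n
    using dec[of n] mult_nonneg_nonneg[OF less_imp_le[OF \<kappa>] zero_le_power2, of "norm (x (Suc n) - x n)"]
    by linarith
  then have mono: "decseq T" by (rule decseq_SucI)
  have "range x \<subseteq> {x. lq_objective A y lam q x \<le> T 0}"
    using decseqD[OF mono, of 0] by (auto simp: T_def)
  then show "bounded (range x)"
    using lq_objective_sublevel_bounded[OF assms(1,3)] bounded_subset by blast
  have T0: "T n \<ge> 0" for n
    using assms(1) by (auto simp: T_def lq_objective_def intro!: add_nonneg_nonneg mult_nonneg_nonneg sum_nonneg)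
  obtain l where "T \<longlonglongrightarrow> l" by (rule decseq_convergent[OF mono allI[OF T0]])
  then have "(\<lambda>n. (T n - T (Suc n)) / \<kappa>) \<longlonglongrightarrow> (l - l) / \<kappa>"
    using \<kappa> by (intro tendsto_intros LIMSEQ_Suc) auto
  then have "(\<lambda>n. (T n - T (Suc n)) / \<kappa>) \<longlonglongrightarrow> 0" by simp
  moreover have "norm ((norm (x (Suc n) - x n))\<^sup>2) \<le> (T n - T (Suc n)) / \<kappa>" for n
    using dec[of n] \<kappa> by (simp add: pos_le_divide_eq mult.commute)
  ultimately have "(\<lambda>n. (norm (x (Suc n) - x n))\<^sup>2) \<longlonglongrightarrow> 0"
    by (intro Lim_null_comparison[of "\<lambda>n. (norm (x (Suc n) - x n))\<^sup>2" "\<lambda>n. (T n - T (Suc n)) / \<kappa>"]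
        always_eventually allI)
  from tendsto_real_sqrt[OF this] have "(\<lambda>n. norm (x (Suc n) - x n)) \<longlonglongrightarrow> 0" by simp
  then show "(\<lambda>n. x (Suc n) - x n) \<longlonglongrightarrow> 0" by (rule tendsto_norm_zero_cancel)
qed

text \<open>Coordinate \<open>i\<close> is updated at some \<open>m n\<close> less than
  \<open>CARD('n)\<close> steps after \<open>r n\<close>. As the steps vanish, the iterates just
  before and just after this update also tend to \<open>p\<close>, so the optimality conditions of
  the new value pass to the limit.\<close>

lemma CCD_cluster_point_stationary:
  fixes A :: "real ^ 'n ^ 'm" and x :: "nat \<Rightarrow> real ^ 'n"
  assumes par: "lam > 0" "mu > 0" "0 < q" "q < 1"
    and step: "\<And>n. x (Suc n) $ idx n = lq_threshold lam mu q
       (x n $ idx n - mu * (column (idx n) A \<bullet> (A *v x n - y))) (x n $ idx n)"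
    and window: "\<And>n i. \<exists>m\<ge>n. m < n + CARD('n) \<and> idx m = i"
    and steps: "(\<lambda>n. x (Suc n) - x n) \<longlonglongrightarrow> 0"
    and r: "filterlim r at_top sequentially" and p: "(\<lambda>n. x (r n)) \<longlonglongrightarrow> p"
  shows "lq_stationary_point A y lam q mu p"
proof -
  define \<eta> where "\<eta> = lq_eta lam mu q"
  define c where "c = lam * mu"
  have \<eta>: "\<eta> > 0" unfolding \<eta>_def using lq_eta_pos par by blast
  have key: "(p $ i \<noteq> 0 \<longrightarrow> \<bar>p $ i\<bar> \<ge> \<eta> \<and>
        column i A \<bullet> (A *v p - y) + lam * q * sgn (p $ i) * \<bar>p $ i\<bar> powr (q - 1) = 0) \<and>
      (p $ i = 0 \<longrightarrow> \<bar>column i A \<bullet> (A *v p - y)\<bar> \<le> lq_tau lam mu q / mu)" for i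
  proof -
    obtain m where m: "\<And>n. m n \<ge> r n" "\<And>n. m n < r n + CARD('n)" "\<And>n. idx (m n) = i"
      using window[of "r _" i] by metis
    define s where "s n = (\<Sum>j<CARD('n). norm (x (Suc (n + j)) - x (n + j)))" for n
    have "(\<lambda>n. norm (x (Suc (n + j)) - x (n + j))) \<longlonglongrightarrow> 0" for j
      using LIMSEQ_ignore_initial_segment[OF tendsto_norm_zero[OF steps], of j] by simp
    then have "s \<longlonglongrightarrow> (\<Sum>j<CARD('n). 0)"
      unfolding s_def[abs_def] by (intro tendsto_sum)
    then have s: "(\<lambda>n. s (r n)) \<longlonglongrightarrow> 0" using filterlim_compose[OF _ r] by simp
    have near: "(\<lambda>n. x (k n)) \<longlonglongrightarrow> p" if k: "\<And>n. r n \<le> k n" "\<And>n. k n \<le> r n + CARD('n)" for k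
    proof -
      have "norm (x (k n) - x (r n)) \<le> s (r n)" for n
        unfolding s_def by (rule dist_within_window[OF k])
      then have "(\<lambda>n. x (k n) - x (r n)) \<longlonglongrightarrow> 0"
        by (intro Lim_null_comparison[OF _ s] always_eventually allI)
      from tendsto_add[OF this p] show ?thesis by simp
    qed
    have "(\<lambda>n. x (m n)) \<longlonglongrightarrow> p" using m(1,2) by (intro near) (auto intro: less_imp_le)
    moreover have "(\<lambda>n. x (Suc (m n))) \<longlonglongrightarrow> p"
      using m(1,2) by (intro near) (auto intro: le_SucI Suc_leI)
    ultimately have xm: "(\<lambda>n. x (m n)) \<longlonglongrightarrow> p" and xm': "(\<lambda>n. x (Suc (m n))) \<longlonglongrightarrow> p" by auto
    define v where "v n = x (Suc (m n)) $ i" for n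
    define z where "z n = x (m n) $ i - mu * (column i A \<bullet> (A *v x (m n) - y))" for n
    define \<rho> where "\<rho> = column i A \<bullet> (A *v p - y)"
    have vt: "v n = lq_threshold lam mu q (z n) (x (m n) $ i)" for n
      using step[of "m n"] by (simp add: v_def z_def m(3))
    have vmin: "prox_energy c q (z n) (v n) \<le> prox_energy c q (z n) w" for n w
      unfolding vt c_def by (rule lq_threshold_min[OF par])
    have v: "v \<longlonglongrightarrow> p $ i" unfolding v_def[abs_def] using xm' by (rule tendsto_vec_nth)
    have z: "z \<longlonglongrightarrow> p $ i - mu * \<rho>"
      unfolding z_def[abs_def] \<rho>_def
      by (intro tendsto_intros tendsto_vec_nth xm
          bounded_linear.tendsto[OF matrix_vector_mul_bounded_linear])
    show ?thesis
    proof (intro conjI impI)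
      assume nz: "p $ i \<noteq> 0"
      have ev: "\<forall>\<^sub>F n in sequentially. v n \<noteq> 0"
        using tendsto_imp_eventually_ne[OF v nz] .
      then have "\<forall>\<^sub>F n in sequentially. \<eta> \<le> \<bar>v n\<bar>"
        by eventually_elim (use nonzero_prox_ge_eta[OF par(1,2,4) vmin[unfolded c_def]] in \<open>simp add: \<eta>_def\<close>)
      then show "\<bar>p $ i\<bar> \<ge> \<eta>"
        using tendsto_lowerbound[OF tendsto_rabs[OF v]] by simp
      have "(\<lambda>n. v n - z n + c * q * sgn (v n) * \<bar>v n\<bar> powr (q - 1)) \<longlonglongrightarrow>
          p $ i - (p $ i - mu * \<rho>) + c * q * sgn (p $ i) * \<bar>p $ i\<bar> powr (q - 1)"
        using nz by (intro tendsto_intros v z) auto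
      moreover have "\<forall>\<^sub>F n in sequentially. v n - z n + c * q * sgn (v n) * \<bar>v n\<bar> powr (q - 1) = 0"
        using ev by eventually_elim (rule nonzero_prox_stationary[OF vmin])
      then have "(\<lambda>n. v n - z n + c * q * sgn (v n) * \<bar>v n\<bar> powr (q - 1)) \<longlonglongrightarrow> 0"
        by (rule tendsto_eventually)
      ultimately have "p $ i - (p $ i - mu * \<rho>) + c * q * sgn (p $ i) * \<bar>p $ i\<bar> powr (q - 1) = 0"
        by (rule LIMSEQ_unique)
      then have "mu * (\<rho> + lam * q * sgn (p $ i) * \<bar>p $ i\<bar> powr (q - 1)) = 0"
        by (simp add: c_def algebra_simps)
      then show "column i A \<bullet> (A *v p - y) + lam * q * sgn (p $ i) * \<bar>p $ i\<bar> powr (q - 1) = 0"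
        using par(2) by (simp add: \<rho>_def)
    next
      \<comment> \<open>Nonzero minimizers have modulus at least \<open>\<eta>\<close>, so updates
        tending to 0 are eventually exactly 0.\<close>
      assume 0: "p $ i = 0"
      have "\<forall>\<^sub>F n in sequentially. \<bar>v n\<bar> < \<eta>"
        using order_tendstoD(2)[OF tendsto_rabs[OF v]] \<eta> by (simp add: 0)
      then have "\<forall>\<^sub>F n in sequentially. \<bar>z n\<bar> \<le> lq_tau lam mu q"
      proof eventually_elim
        case (elim n)
        then have "v n = 0"
          using nonzero_prox_ge_eta[OF par(1,2,4) vmin[unfolded c_def], of n] by (auto simp: \<eta>_def)
        then show ?case
          using prox_energy_zero_min_iff_tau[OF par(1,2,4), of "z n"] vmin[of n] by (simp add: c_def)
      qed
      then have "\<bar>p $ i - mu * \<rho>\<bar> \<le> lq_tau lam mu q"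
        using tendsto_upperbound[OF tendsto_rabs[OF z]] by simp
      then show "\<bar>column i A \<bullet> (A *v p - y)\<bar> \<le> lq_tau lam mu q / mu"
        using par(2) by (simp add: 0 \<rho>_def abs_mult pos_le_divide_eq mult.commute)
    qed
  qed
  then show ?thesis by (auto simp: lq_stationary_point_def Supp_def \<eta>_def)
qed

text \<open>A change of sign would force the coordinate, whose image is an interval, to take the
  value \<open>\<eta> / 2\<close> or \<open>- \<eta> / 2\<close> inside the forbidden gap.\<close>

lemma connected_gap_sgn_constant:
  fixes C :: "(real ^ 'n) set"
  assumes "connected C" "\<eta> > 0" and gap: "\<And>u. u \<in> C \<Longrightarrow> u $ i \<noteq> 0 \<Longrightarrow> \<eta> \<le> \<bar>u $ i\<bar>"
    and "u \<in> C" "u' \<in> C"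
  shows "sgn (u $ i) = sgn (u' $ i)"
proof -
  have conn: "connected ((\<lambda>u. u $ i) ` C)"
    using assms(1) by (intro connected_continuous_image continuous_intros)
  have le: "sgn (u $ i) = sgn (u' $ i)" if u: "u \<in> C" "u' \<in> C" and le: "u $ i \<le> u' $ i" for u u'
  proof (rule ccontr)
    assume ne: "sgn (u $ i) \<noteq> sgn (u' $ i)"
    define t where "t = (if u $ i < 0 then - \<eta> / 2 else \<eta> / 2)"
    have "u $ i \<le> t \<and> t \<le> u' $ i"
      using gap[OF u(1)] gap[OF u(2)] ne le \<open>\<eta> > 0\<close>
      by (auto simp: t_def sgn_if split: if_splits)
    then have "t \<in> (\<lambda>u. u $ i) ` C"
      using connectedD_interval[OF conn, of "u $ i" "u' $ i" t] u by auto
    then obtain w where "w \<in> C" "w $ i = t" by auto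
    with gap[of w] \<open>\<eta> > 0\<close> show False by (auto simp: t_def split: if_splits)
  qed
  from le[OF assms(4,5)] le[OF assms(5,4)] show ?thesis by (metis linear)
qed

text \<open>The lower bound \<open>lq_eta\<close> on nonzero entries fixes the signs
  \<open>\<sigma>\<close> on \<open>C\<close>. The logarithms \<open>lg\<close> then map
  \<open>C\<close> continuously to a connected set of solutions of one exponential equation.\<close>

lemma stationary_points_scattered:
  fixes A :: "real ^ 'n ^ 'm"
  assumes par: "lam > 0" "mu > 0" "0 < q" "q < 1"
    and stat: "\<And>u. u \<in> C \<Longrightarrow> lq_stationary_point A y lam q mu u"
    and C: "connected C" and p: "p \<in> C" "p' \<in> C"
  shows "p = p'"
proof -
  define \<sigma> where "\<sigma> i = sgn (p $ i)" for i
  define lg where "lg u = (\<chi> i. if \<sigma> i = 0 then 0 else ln \<bar>u $ i\<bar>)" for u :: "real ^ 'n"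
  \<comment> \<open>Coordinates off the support get a zero column and the trivial equation \<open>s * exp 0 = s\<close>.\<close>
  define A' :: "real ^ 'n ^ 'm" where "A' = (\<chi> r i. \<sigma> i * A $ r $ i)"
  define b where "b = (\<chi> i. if \<sigma> i = 0 then lam * q else \<sigma> i * (column i A \<bullet> y))"
  have eta: "lq_eta lam mu q > 0" using lq_eta_pos par by blast
  have gap: "lq_eta lam mu q \<le> \<bar>u $ i\<bar>" if "u \<in> C" "u $ i \<noteq> 0" for u i
    using stat[OF that(1)] that(2) by (auto simp: lq_stationary_point_def Supp_def)
  have sgn: "sgn (u $ i) = \<sigma> i" if "u \<in> C" for u i
    unfolding \<sigma>_def by (rule connected_gap_sgn_constant[OF C eta gap that p(1)])
  have nz: "u $ i \<noteq> 0 \<longleftrightarrow> \<sigma> i \<noteq> 0" if "u \<in> C" for u i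
    using sgn[OF that, of i] by (metis sgn_0_0)
  have \<sigma>2: "\<sigma> i * \<sigma> i = 1" if "\<sigma> i \<noteq> 0" for i
    using that by (simp add: \<sigma>_def sgn_if split: if_splits)
  have exp_lg: "\<sigma> i * exp (lg u $ i) = u $ i" if "u \<in> C" for u i
    using nz[OF that, of i] sgn[OF that, of i] mult_sgn_abs[of "u $ i"]
    by (cases "\<sigma> i = 0") (simp_all add: lg_def)
  have A'_exp: "A' *v (\<chi> k. exp (lg u $ k)) = A *v u" if "u \<in> C" for u
    by (simp add: A'_def matrix_vector_mult_def vec_eq_iff exp_lg[OF that, symmetric] mult_ac)
  have A'_t: "(transpose A' *v w) $ i = \<sigma> i * (column i A \<bullet> w)" for w i
    by (simp add: A'_def matrix_vector_mult_def transpose_def column_def inner_vec_def sum_distrib_left mult_ac)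
  have "connected (lg ` C)"
  proof (rule connected_continuous_image[OF _ C])
    have "continuous_on C (\<lambda>u. if \<sigma> i = 0 then 0 else ln \<bar>u $ i\<bar>)" for i
      using nz by (cases "\<sigma> i = 0") (auto intro!: continuous_intros)
    then show "continuous_on C lg" unfolding lg_def[abs_def] by (intro continuous_on_vec_lambda)
  qed
  have "lg p = lg p'"
  proof (rule exp_gram_critical_set_scattered[of "lam * q" q "lg ` C" A' b])
    fix w i assume "w \<in> lg ` C"
    then obtain u where u: "u \<in> C" "w = lg u" by auto
    show "(transpose A' *v (A' *v (\<chi> k. exp (w $ k)))) $ i + lam * q * exp ((q - 1) * w $ i) = b $ i"
    proof (cases "\<sigma> i = 0")
      case True
      then show ?thesis unfolding u(2) A'_exp[OF u(1)] A'_t by (simp add: lg_def b_def)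
    next
      case False
      then have ui: "u $ i \<noteq> 0" using nz[OF u(1)] by blast
      then have "column i A \<bullet> (A *v u - y) + lam * q * \<sigma> i * \<bar>u $ i\<bar> powr (q - 1) = 0"
        using stat[OF u(1)] ui
        unfolding sgn[OF u(1), of i, symmetric] by (simp add: lq_stationary_point_def Supp_def)
      \<comment> \<open>Multiplication by \<open>\<sigma> i\<close>, whose square is 1 on the
        support, brings the stationarity condition into the form with \<open>A'\<close> and
        \<open>b\<close>.\<close>
      then have "\<sigma> i * (column i A \<bullet> (A *v u)) + lam * q * (\<sigma> i * \<sigma> i) * \<bar>u $ i\<bar> powr (q - 1) =
          \<sigma> i * (column i A \<bullet> y)"
        unfolding inner_diff_right by algebra
      moreover have "exp ((q - 1) * lg u $ i) = \<bar>u $ i\<bar> powr (q - 1)"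
        using False ui by (simp add: lg_def powr_def)
      ultimately show ?thesis
        unfolding u(2) A'_exp[OF u(1)] A'_t using False by (simp add: b_def \<sigma>2)
    qed
  qed (use par p \<open>connected (lg ` C)\<close> in auto)
  then show ?thesis
    using exp_lg[OF p(1)] exp_lg[OF p(2)] by (simp add: vec_eq_iff)
qed

theorem theorem5:
  fixes A :: "real ^ 'n ^ 'm" and y :: "real ^ 'm"
    and lam q mu :: real
    and e :: "nat \<Rightarrow> 'n"
    and x :: "nat \<Rightarrow> real ^ 'n"
  assumes "lam > 0" and "0 < q" and "q < 1"
    and "bij_betw e {1..CARD('n)} UNIV"
    and "CCD_sequence e A y lam q mu x"
    and "0 < mu" and "ereal mu < inverse (ereal (Lmax A))"
    and "ereal (lq_objective A y lam q (x 0)) < \<infinity>"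
  shows "\<exists>xstar. lq_stationary_point A y lam q mu xstar \<and> x \<longlonglongrightarrow> xstar"
proof -
  obtain idx where step: "\<And>n. x (Suc n) $ idx n = lq_threshold lam mu q
       (x n $ idx n - mu * (column (idx n) A \<bullet> (A *v x n - y))) (x n $ idx n)"
    and same: "\<And>n j. j \<noteq> idx n \<Longrightarrow> x (Suc n) $ j = x n $ j"
    and window: "\<And>n i. \<exists>m\<ge>n. m < n + CARD('n) \<and> idx m = i"
    by (rule CCD_sequence_index[OF assms(5,4)]) (rule that, assumption+)
  have "Lmax A \<ge> (norm (column undefined A))\<^sup>2" unfolding Lmax_def by (rule Max_ge) auto
  then have "Lmax A \<ge> 0" by (rule order_trans[OF zero_le_power2])
  \<comment> \<open>For \<open>Lmax A = 0\<close> the hypothesis on \<open>mu\<close> reads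
    \<open>ereal mu < \<infinity>\<close>, and the claim is just \<open>0 < 1 / mu\<close>.\<close>
  then have L: "Lmax A < 1 / mu"
    using assms(6,7) by (cases "Lmax A = 0") (simp_all add: field_simps)
  note bs = CCD_bounded_vanishing_steps[where x = x and idx = idx, OF assms(1,6,2,3) L step same]
  have "\<exists>p\<in>{p. lq_stationary_point A y lam q mu p}. x \<longlonglongrightarrow> p"
  proof (rule convergent_of_scattered_cluster_points[OF bs])
    show "p \<in> {p. lq_stationary_point A y lam q mu p}"
      if "filterlim r at_top sequentially" "(\<lambda>n. x (r n)) \<longlonglongrightarrow> p" for p r
      using CCD_cluster_point_stationary[where x = x and idx = idx, OF assms(1,6,2,3) step window bs(2) that] by simp
    show "p = p'" if "C \<subseteq> {p. lq_stationary_point A y lam q mu p}" "connected C" "p \<in> C" "p' \<in> C"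
      for C p p'
      by (rule stationary_points_scattered[OF assms(1,6,2,3) _ that(2-4)]) (use that(1) in auto)
  qed
  then show ?thesis by auto
qed

end
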